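(* For a function $\sigma:\mathbb{Z}^n\times\mathbb{T}^n\to\mathbb{C}$ define $\tau(x,k):=\overline{\sigma(-k,x)}$. Then $$\mathrm{Op}_{\mathbb{Z}^n}(\sigma)=\mathcal{F}_{\mathbb{Z}^n}^{-1}\circ\mathrm{Op}_{\mathbb{T}^n}(\tau)^*\circ\mathcal{F}_{\mathbb{Z}^n},$$ where $\mathrm{Op}_{\mathbb{T}^n}(\tau)^*$ is the adjoint of the toroidal pseudo-differential operator $\mathrm{Op}_{\mathbb{T}^n}(\tau)$. We also have $$\mathrm{Op}_{\mathbb{T}^n}(\tau)=\mathcal{F}_{\mathbb{Z}^n}\circ\mathrm{Op}_{\mathbb{Z}^n}(\sigma)^*\circ\mathcal{F}_{\mathbb{Z}^n}^{-1},$$ where $\mathrm{Op}_{\mathbb{Z}^n}(\sigma)^*$ is the adjoint of the pseudo-difference operator $\mathrm{Op}_{\mathbb{Z}^n}(\sigma)$.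
   Context: $\mathbb{T}^n=\mathbb{R}^n/\mathbb{Z}^n$. Lattice Fourier transform: $(\mathcal{F}_{\mathbb{Z}^n}f)(x)=\sum_{k\in\mathbb{Z}^n}e^{-2\pi i k\cdot x}f(k)$, with inverse $\mathcal{F}_{\mathbb{Z}^n}^{-1}v(k)=\int_{\mathbb{T}^n}e^{2\pi i k\cdot x}v(x)\,dx$; it is unitary from $\ell^2(\mathbb{Z}^n)$ to $L^2(\mathbb{T}^n)$. Toroidal Fourier transform: $(\mathcal{F}_{\mathbb{T}^n}v)(k)=\int_{\mathbb{T}^n}e^{-2\pi i x\cdot k}v(x)\,dx=\mathcal{F}_{\mathbb{Z}^n}^{-1}v(-k)$. Lattice quantization (pseudo-difference operator with symbol $\sigma:\mathbb{Z}^n\times\mathbb{T}^n\to\mathbb{C}$): $\mathrm{Op}_{\mathbb{Z}^n}(\sigma)f(k)=\int_{\mathbb{T}^n}e^{2\pi i k\cdot x}\sigma(k,x)(\mathcal{F}_{\mathbb{Z}^n}f)(x)\,dx$, $k\in\mathbb{Z}^n$. Toroidal quantization (symbol $\tau:\mathbb{T}^n\times\mathbb{Z}^n\to\mathbb{C}$): $\mathrm{Op}_{\mathbb{T}^n}(\tau)v(x)=\sum_{k\in\mathbb{Z}^n}e^{2\pi i x\cdot k}\tau(x,k)(\mathcal{F}_{\mathbb{T}^n}v)(k)$ for $v\in C^\infty(\mathbb{T}^n)$. Adjoints are taken with respect to the inner products of $\ell^2(\mathbb{Z}^n)$ and $L^2(\mathbb{T}^n)$.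
   Formalization: Added so the adjoints exist: the toroidal operator of τ maps C^∞(T^n) into L^2(T^n), its series converging a.e.; for the second identity, the pseudo-difference operator of σ has dense domain in ℓ^2(Z^n). The second identity is stated a.e. for v in C^∞(T^n). *)

theory Defs
  imports "HOL-Analysis.Analysis"
begin

text \<open>
  The lattice of dimension \<open>n = CARD('n)\<close> is the type \<open>int ^ 'n\<close>. A function on the torus is a
  function on \<open>real ^ 'n\<close> that is periodic with respect to the integer vectors, and integrals over
  the torus are Lebesgue integrals over the unit cube. Elements of \<open>L\<^sup>2\<close> are represented by functions,
  so equality in \<open>L\<^sup>2\<close> is equality almost everywhere.
\<close>

definition of_lattice :: "int ^ 'n \<Rightarrow> real ^ 'n"
  where "of_lattice k = (\<chi> i. real_of_int (k $ i))"

definition periodic :: "(real ^ 'n \<Rightarrow> complex) \<Rightarrow> bool"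
  where "periodic v \<longleftrightarrow> (\<forall>x m. v (x + of_lattice m) = v x)"

abbreviation torus :: "(real ^ 'n) measure"
  where "torus \<equiv> lebesgue_on (cbox 0 1)"

text \<open>The character \<open>x \<mapsto> exp (2 \<pi> i k \<cdot> x)\<close>; its complex conjugate is \<open>ch (- k)\<close>.\<close>

definition ch :: "int ^ 'n \<Rightarrow> real ^ 'n \<Rightarrow> complex"
  where "ch k x = exp (2 * of_real pi * \<i> * of_real (of_lattice k \<bullet> x))"

primrec C_k :: "nat \<Rightarrow> (real ^ 'n \<Rightarrow> complex) \<Rightarrow> bool" where
  "C_k 0 v \<longleftrightarrow> continuous_on UNIV v"
| "C_k (Suc r) v \<longleftrightarrow> (\<forall>x. v differentiable (at x)) \<and>
     (\<forall>i. C_k r (\<lambda>x. frechet_derivative v (at x) (axis i 1)))"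

definition C_inf_torus :: "(real ^ 'n \<Rightarrow> complex) set"
  where "C_inf_torus = {v. periodic v \<and> (\<forall>r. C_k r v)}"

definition L2_torus :: "(real ^ 'n \<Rightarrow> complex) set"
  where "L2_torus = {v. periodic v \<and> v \<in> borel_measurable torus \<and>
     integrable torus (\<lambda>x. (cmod (v x))\<^sup>2)}"

definition inner_torus :: "(real ^ 'n \<Rightarrow> complex) \<Rightarrow> (real ^ 'n \<Rightarrow> complex) \<Rightarrow> complex"
  where "inner_torus v w = (LINT x|torus. v x * cnj (w x))"

definition l2_lattice :: "(int ^ 'n \<Rightarrow> complex) set"
  where "l2_lattice = {f. (\<lambda>k. (cmod (f k))\<^sup>2) summable_on UNIV}"

definition inner_lattice :: "(int ^ 'n \<Rightarrow> complex) \<Rightarrow> (int ^ 'n \<Rightarrow> complex) \<Rightarrow> complex"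
  where "inner_lattice f g = (\<Sum>\<^sub>\<infinity>k. f k * cnj (g k))"

definition dense_l2_lattice :: "(int ^ 'n \<Rightarrow> complex) set \<Rightarrow> bool"
  where "dense_l2_lattice D \<longleftrightarrow>
     (\<forall>g\<in>l2_lattice. \<forall>e>0. \<exists>f\<in>D. (\<Sum>\<^sub>\<infinity>k. (cmod (g k - f k))\<^sup>2) < e)"

text \<open>
  For a general \<open>f\<close> in \<open>\<ell>\<^sup>2\<close> the series \<open>\<Sum>k. exp (- 2 \<pi> i k \<cdot> x) f(k)\<close> need not converge absolutely
  at any point, so the lattice Fourier transform on \<open>\<ell>\<^sup>2\<close> is the \<open>L\<^sup>2\<close>-sum of the series. The sum is
  determined up to a null set, and a representative is chosen.
\<close>

definition lattice_FT :: "(int ^ 'n \<Rightarrow> complex) \<Rightarrow> real ^ 'n \<Rightarrow> complex"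
  where "lattice_FT f = (SOME v. v \<in> L2_torus \<and>
     ((\<lambda>K. LINT x|torus. (cmod (v x - (\<Sum>k\<in>K. ch (- k) x * f k)))\<^sup>2) \<longlongrightarrow> 0)
       (finite_subsets_at_top UNIV))"

definition lattice_FT_inv :: "(real ^ 'n \<Rightarrow> complex) \<Rightarrow> int ^ 'n \<Rightarrow> complex"
  where "lattice_FT_inv v k = (LINT x|torus. ch k x * v x)"

definition torus_FT :: "(real ^ 'n \<Rightarrow> complex) \<Rightarrow> int ^ 'n \<Rightarrow> complex"
  where "torus_FT v k = (LINT x|torus. ch (- k) x * v x)"

definition Op_lattice ::
  "(int ^ 'n \<Rightarrow> real ^ 'n \<Rightarrow> complex) \<Rightarrow> (int ^ 'n \<Rightarrow> complex) \<Rightarrow> int ^ 'n \<Rightarrow> complex"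
  where "Op_lattice \<sigma> f k = (LINT x|torus. ch k x * \<sigma> k x * lattice_FT f x)"

text \<open>The maximal domain on which \<open>Op_lattice \<sigma>\<close> acts as an operator in \<open>\<ell>\<^sup>2\<close>.\<close>

definition dom_lattice :: "(int ^ 'n \<Rightarrow> real ^ 'n \<Rightarrow> complex) \<Rightarrow> (int ^ 'n \<Rightarrow> complex) set"
  where "dom_lattice \<sigma> = {f \<in> l2_lattice.
     (\<forall>k. integrable torus (\<lambda>x. ch k x * \<sigma> k x * lattice_FT f x)) \<and>
     Op_lattice \<sigma> f \<in> l2_lattice}"

definition Op_torus ::
  "(real ^ 'n \<Rightarrow> int ^ 'n \<Rightarrow> complex) \<Rightarrow> (real ^ 'n \<Rightarrow> complex) \<Rightarrow> real ^ 'n \<Rightarrow> complex"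
  where "Op_torus \<tau> v x = (\<Sum>\<^sub>\<infinity>k. ch k x * \<tau> x k * torus_FT v k)"

text \<open>
  \<open>Op_torus \<tau>\<close> is an operator from the smooth functions to \<open>L\<^sup>2\<close>: the defining series converges
  almost everywhere and its sum is square integrable.
\<close>

definition Op_torus_well_defined :: "(real ^ 'n \<Rightarrow> int ^ 'n \<Rightarrow> complex) \<Rightarrow> bool"
  where "Op_torus_well_defined \<tau> \<longleftrightarrow> (\<forall>v\<in>C_inf_torus.
     (AE x in torus. (\<lambda>k. ch k x * \<tau> x k * torus_FT v k) summable_on UNIV) \<and>
     Op_torus \<tau> v \<in> L2_torus)"

text \<open>
  The adjoint of an operator \<open>A\<close> with domain \<open>D\<close> in a Hilbert space with elements \<open>H\<close> and inner
  product \<open>ip\<close>. For a dense \<open>D\<close> the value of the adjoint is unique as an element of the Hilbert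
  space, hence the choice in \<open>adjoint_op\<close> is only that of a representative.
\<close>

definition is_adjoint_value ::
  "'a set \<Rightarrow> ('a \<Rightarrow> 'a \<Rightarrow> complex) \<Rightarrow> 'a set \<Rightarrow> ('a \<Rightarrow> 'a) \<Rightarrow> 'a \<Rightarrow> 'a \<Rightarrow> bool"
  where "is_adjoint_value H ip D A g h \<longleftrightarrow> h \<in> H \<and> (\<forall>f\<in>D. ip (A f) g = ip f h)"

definition adjoint_dom ::
  "'a set \<Rightarrow> ('a \<Rightarrow> 'a \<Rightarrow> complex) \<Rightarrow> 'a set \<Rightarrow> ('a \<Rightarrow> 'a) \<Rightarrow> 'a set"
  where "adjoint_dom H ip D A = {g \<in> H. \<exists>h. is_adjoint_value H ip D A g h}"

definition adjoint_op ::
  "'a set \<Rightarrow> ('a \<Rightarrow> 'a \<Rightarrow> complex) \<Rightarrow> 'a set \<Rightarrow> ('a \<Rightarrow> 'a) \<Rightarrow> 'a \<Rightarrow> 'a"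
  where "adjoint_op H ip D A g = (SOME h. is_adjoint_value H ip D A g h)"

abbreviation "dom_Op_torus_adj \<tau> \<equiv>
  adjoint_dom L2_torus inner_torus C_inf_torus (Op_torus \<tau>)"

abbreviation "Op_torus_adj \<tau> \<equiv>
  adjoint_op L2_torus inner_torus C_inf_torus (Op_torus \<tau>)"

abbreviation "dom_Op_lattice_adj \<sigma> \<equiv>
  adjoint_dom l2_lattice inner_lattice (dom_lattice \<sigma>) (Op_lattice \<sigma>)"

abbreviation "Op_lattice_adj \<sigma> \<equiv>
  adjoint_op l2_lattice inner_lattice (dom_lattice \<sigma>) (Op_lattice \<sigma>)"

end

theory Submission
  imports Defs
begin

text \<open>
  Write \<open>g\<^sub>k(x) = exp (2 \<pi> i k \<cdot> x) \<tau>(x, k)\<close>, so that \<open>Op(\<tau>) v = \<Sum>k. v^(k) g\<^sub>k\<close> and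
  \<open>Op(\<sigma>) f (k)\<close> is the conjugate of \<open>\<langle>g\<^bsub>-k\<^esub>, f^\<rangle>\<close>. Both identities then reduce to
  \<open>\<langle>Op(\<tau>) v, \<phi>\<rangle> = \<Sum>k. v^(k) \<langle>g\<^sub>k, \<phi>\<rangle>\<close> for smooth \<open>v\<close>, Parseval's identity and Fourier inversion in
  \<open>L\<^sup>2\<close>. The interchange of sum and integral needs a bound on the norms of the \<open>g\<^sub>k\<close>, although
  \<open>Op(\<tau>) v\<close> is only assumed to lie in \<open>L\<^sup>2\<close> for each single smooth \<open>v\<close>. Smooth functions correspond to
  rapidly decreasing coefficients \<open>a\<close>, and restricting \<open>a\<close> to an arbitrary set of frequencies keeps it
  rapidly decreasing; hence all subsums of \<open>\<Sum>k. a(k) g\<^sub>k\<close> are in \<open>L\<^sup>2\<close>, and a Baire category argument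
  over the subsets shows that the norms of the terms are bounded. Applied to \<open>a\<close> times a large
  polynomial weight, this makes \<open>\<Sum>k. a(k) g\<^sub>k\<close> absolutely convergent in \<open>L\<^sup>2\<close>.
\<close>

subsection \<open>Square integrable functions\<close>

text \<open>For a trigonometric polynomial \<open>v\<close> linearity would replace the interchange,
  but the domain of an adjoint is tested against every smooth \<open>v\<close>, and no growth
  condition in the frequency is imposed on the symbol. What helps is that unordered convergence of
  complex series is absolute, so almost everywhere all subseries converge as well.

  The two identities treat the choice inside the adjoint differently. On the torus, characters are
  test functions, so all adjoint values of \<open>lattice_FT f\<close> share their Fourier
  coefficients, and \<open>lattice_FT_inv\<close> sees nothing else. On the lattice the maximal
  domain may fail to be dense: for \<open>\<tau> x k = ch (- k) x\<close> the toroidal operator is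
  evaluation at 0, and its adjoint lives on functions of mean zero. Under density the adjoint value
  is unique as a function.

  Completeness of the characters serves to return from coefficients to functions in the second
  identity. The closed cube is not the torus, as opposite faces must be identified; approximating
  functions that vanish on the faces avoids building the quotient.\<close>

definition square_integrable :: "'a measure \<Rightarrow> ('a \<Rightarrow> complex) \<Rightarrow> bool"
  where "square_integrable M f \<longleftrightarrow>
    f \<in> borel_measurable M \<and> integrable M (\<lambda>x. (cmod (f x))\<^sup>2)"

lemma square_integrable_measurable[measurable_dest]:
  "square_integrable M f \<Longrightarrow> f \<in> borel_measurable M"
  by (simp add: square_integrable_def)

lemma square_integrable_integrable:
  "square_integrable M f \<Longrightarrow> integrable M (\<lambda>x. (cmod (f x))\<^sup>2)"
  by (simp add: square_integrable_def)

lemma square_integrable_norm_mult: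
  assumes "square_integrable M f" "square_integrable M g"
  shows "integrable M (\<lambda>x. cmod (f x) * cmod (g x))"
proof (rule Bochner_Integration.integrable_bound)
  show "integrable M (\<lambda>x. (cmod (f x))\<^sup>2 + (cmod (g x))\<^sup>2)"
    using assms by (intro Bochner_Integration.integrable_add square_integrable_integrable)
  show "(\<lambda>x. cmod (f x) * cmod (g x)) \<in> borel_measurable M"
    using assms[THEN square_integrable_measurable] by measurable
  show "AE x in M. norm (cmod (f x) * cmod (g x)) \<le> norm ((cmod (f x))\<^sup>2 + (cmod (g x))\<^sup>2)"
  proof (rule AE_I2)
    fix x
    have *: "0 \<le> (cmod (f x) - cmod (g x))\<^sup>2" "0 \<le> cmod (f x) * cmod (g x)" by auto
    then have "cmod (f x) * cmod (g x) \<le> (cmod (f x))\<^sup>2 + (cmod (g x))\<^sup>2"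
      unfolding power2_diff by linarith
    with * show "norm (cmod (f x) * cmod (g x)) \<le> norm ((cmod (f x))\<^sup>2 + (cmod (g x))\<^sup>2)"
      by simp
  qed
qed

lemma square_integrable_mult:
  assumes "square_integrable M f" "square_integrable M g"
  shows "integrable M (\<lambda>x. f x * g x)"
  by (rule Bochner_Integration.integrable_bound[OF square_integrable_norm_mult[OF assms]])
    (use assms[THEN square_integrable_measurable] in \<open>auto simp: norm_mult\<close>)

lemma square_integrable_cnj:
  "square_integrable M f \<Longrightarrow> square_integrable M (\<lambda>x. cnj (f x))"
  by (auto simp: square_integrable_def
      intro!: borel_measurable_continuous_on[where f = cnj] continuous_intros)

lemma square_integrable_mult_cnj:
  "square_integrable M f \<Longrightarrow> square_integrable M g \<Longrightarrow> integrable M (\<lambda>x. f x * cnj (g x))"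
  by (intro square_integrable_mult square_integrable_cnj)

lemma square_integrable_bounded_mult:
  assumes "square_integrable M f" "b \<in> borel_measurable M" "\<And>x. cmod (b x) \<le> C"
  shows "square_integrable M (\<lambda>x. b x * f x)"
  unfolding square_integrable_def
proof
  show m: "(\<lambda>x. b x * f x) \<in> borel_measurable M"
    using assms(1)[THEN square_integrable_measurable] assms(2) by measurable
  show "integrable M (\<lambda>x. (cmod (b x * f x))\<^sup>2)"
  proof (rule Bochner_Integration.integrable_bound)
    show "integrable M (\<lambda>x. C\<^sup>2 * (cmod (f x))\<^sup>2)"
      using assms(1) by (simp add: square_integrable_integrable)
    show "AE x in M. norm ((cmod (b x * f x))\<^sup>2) \<le> norm (C\<^sup>2 * (cmod (f x))\<^sup>2)"
      using assms(3) by (auto simp: norm_mult power_mult_distrib intro!: mult_right_mono power_mono)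
  qed (use m in measurable)
qed

lemma square_integrable_cmult:
  "square_integrable M f \<Longrightarrow> square_integrable M (\<lambda>x. c * f x)"
  by (rule square_integrable_bounded_mult[where C = "cmod c"]) auto

lemma square_integrable_add:
  assumes "square_integrable M f" "square_integrable M g"
  shows "square_integrable M (\<lambda>x. f x + g x)"
  unfolding square_integrable_def
proof
  show m: "(\<lambda>x. f x + g x) \<in> borel_measurable M"
    using assms[THEN square_integrable_measurable] by measurable
  show "integrable M (\<lambda>x. (cmod (f x + g x))\<^sup>2)"
  proof (rule Bochner_Integration.integrable_bound)
    show "integrable M (\<lambda>x. 2 * (cmod (f x))\<^sup>2 + 2 * (cmod (g x))\<^sup>2)"
      using assms by (simp add: square_integrable_integrable)
    show "AE x in M. norm ((cmod (f x + g x))\<^sup>2) \<le> norm (2 * (cmod (f x))\<^sup>2 + 2 * (cmod (g x))\<^sup>2)"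
    proof (rule AE_I2)
      fix x
      have "(cmod (f x + g x))\<^sup>2 \<le> (cmod (f x) + cmod (g x))\<^sup>2"
        by (intro power_mono norm_triangle_ineq) auto
      moreover have "0 \<le> (cmod (f x) - cmod (g x))\<^sup>2" by simp
      ultimately show "norm ((cmod (f x + g x))\<^sup>2) \<le> norm (2 * (cmod (f x))\<^sup>2 + 2 * (cmod (g x))\<^sup>2)"
        by (simp add: power2_diff power2_sum)
    qed
  qed (use m in measurable)
qed

lemma square_integrable_diff:
  assumes "square_integrable M f" "square_integrable M g"
  shows "square_integrable M (\<lambda>x. f x - g x)"
  using square_integrable_add[OF assms(1) square_integrable_cmult[OF assms(2), of "-1"]] by simp

lemma square_integrable_zero: "square_integrable M (\<lambda>x. 0)"
  by (simp add: square_integrable_def)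

lemma square_integrable_sum:
  assumes "\<And>i. i \<in> I \<Longrightarrow> square_integrable M (f i)"
  shows "square_integrable M (\<lambda>x. \<Sum>i\<in>I. f i x)"
proof (cases "finite I")
  case True
  then show ?thesis
    using assms by (induction I) (auto intro: square_integrable_add simp: square_integrable_zero)
qed (simp add: square_integrable_zero)

text \<open>Cauchy-Schwarz from the nonnegativity of a quadratic form. Keeping two variables lets
  the same form settle the degenerate case \<open>A = 0\<close>.\<close>

lemma integral_norm_mult_le:
  assumes "square_integrable M f" "square_integrable M g"
  shows "(LINT x|M. cmod (f x) * cmod (g x)) \<le>
    sqrt (LINT x|M. (cmod (f x))\<^sup>2) * sqrt (LINT x|M. (cmod (g x))\<^sup>2)"
proof -
  define A where "A = (LINT x|M. (cmod (f x))\<^sup>2)"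
  define B where "B = (LINT x|M. (cmod (g x))\<^sup>2)"
  define P where "P = (LINT x|M. cmod (f x) * cmod (g x))"
  have nn: "A \<ge> 0" "B \<ge> 0" by (auto simp: A_def B_def)
  note int = assms[THEN square_integrable_integrable] square_integrable_norm_mult[OF assms]
  have quad: "0 \<le> A * s\<^sup>2 - 2 * P * s * t + B * t\<^sup>2" for s t :: real
  proof -
    have "0 \<le> (LINT x|M. (s * cmod (f x) - t * cmod (g x))\<^sup>2)" by simp
    also have "\<dots> = (LINT x|M. s\<^sup>2 * (cmod (f x))\<^sup>2 - 2 * s * t * (cmod (f x) * cmod (g x))
        + t\<^sup>2 * (cmod (g x))\<^sup>2)"
      by (simp add: power2_diff power_mult_distrib algebra_simps)
    also have "\<dots> = s\<^sup>2 * A - 2 * s * t * P + t\<^sup>2 * B"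
      unfolding A_def B_def P_def using int by simp
    finally show ?thesis by (simp add: mult_ac)
  qed
  have "P\<^sup>2 \<le> A * B"
  proof (cases "A = 0")
    case True
    have "P = 0"
    proof (rule ccontr)
      assume "P \<noteq> 0"
      \<comment> \<open>Without its \<open>A\<close> term the form is linear in \<open>s\<close>; at
        this point its value is -1.\<close>
      with quad[of "(B + 1) / (2 * P)" 1] True show False by (simp add: field_simps)
    qed
    then show ?thesis using nn by simp
  next
    case False
    with nn have "A > 0" by simp
    \<comment> \<open>The form at \<open>s = P\<close>, \<open>t = A\<close>, where the mixed term
      is twice the first.\<close>
    have "A * (P\<^sup>2) \<le> A * (A * B)"
      using quad[of P A] by (simp add: power2_eq_square algebra_simps)
    with \<open>A > 0\<close> show ?thesis by simp
  qed
  then have "P \<le> sqrt (A * B)"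
    by (metis abs_le_D1 real_sqrt_abs real_sqrt_le_iff)
  then show ?thesis by (simp add: A_def B_def P_def real_sqrt_mult)
qed

lemma norm_integral_mult_cnj_le:
  assumes "square_integrable M f" "square_integrable M g"
  shows "cmod (LINT x|M. f x * cnj (g x)) \<le>
    sqrt (LINT x|M. (cmod (f x))\<^sup>2) * sqrt (LINT x|M. (cmod (g x))\<^sup>2)"
proof -
  have "cmod (LINT x|M. f x * cnj (g x)) \<le> (LINT x|M. cmod (f x * cnj (g x)))"
    by (rule integral_norm_bound)
  also have "\<dots> = (LINT x|M. cmod (f x) * cmod (g x))" by (simp add: norm_mult)
  finally show ?thesis using integral_norm_mult_le[OF assms] by simp
qed

lemma integral_norm_diff_square:
  assumes "square_integrable M f" "square_integrable M g"
  shows "complex_of_real (LINT x|M. (cmod (f x - g x))\<^sup>2) =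
    (LINT x|M. f x * cnj (f x)) - (LINT x|M. f x * cnj (g x)) - (LINT x|M. g x * cnj (f x))
     + (LINT x|M. g x * cnj (g x))"
proof -
  have "complex_of_real (LINT x|M. (cmod (f x - g x))\<^sup>2)
    = (LINT x|M. complex_of_real ((cmod (f x - g x))\<^sup>2))"
    by (rule integral_complex_of_real[symmetric])
  also have "\<dots> = (LINT x|M. f x * cnj (f x) - f x * cnj (g x) - g x * cnj (f x) + g x * cnj (g x))"
    by (intro Bochner_Integration.integral_cong)
      (simp_all only: complex_norm_square complex_cnj_diff, simp_all add: algebra_simps)
  finally show ?thesis
    using assms by (simp add: square_integrable_mult_cnj)
qed

text \<open>Continuity of the inner product, by Cauchy-Schwarz. The filter is arbitrary because
  partial sums over the lattice converge along \<open>finite_subsets_at_top\<close>.\<close>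

lemma tendsto_integral_mult_cnj:
  assumes "\<And>i. square_integrable M (f i)" "square_integrable M v" "square_integrable M w"
    and "((\<lambda>i. LINT x|M. (cmod (v x - f i x))\<^sup>2) \<longlongrightarrow> 0) F"
  shows "((\<lambda>i. LINT x|M. f i x * cnj (w x)) \<longlongrightarrow> (LINT x|M. v x * cnj (w x))) F"
proof (rule Lim_null[THEN iffD2], rule Lim_null_comparison)
  show "\<forall>\<^sub>F i in F. norm ((LINT x|M. f i x * cnj (w x)) - (LINT x|M. v x * cnj (w x))) \<le>
     sqrt (LINT x|M. (cmod (v x - f i x))\<^sup>2) * sqrt (LINT x|M. (cmod (w x))\<^sup>2)"
  proof (intro always_eventually allI)
    fix i
    have "norm ((LINT x|M. f i x * cnj (w x)) - (LINT x|M. v x * cnj (w x)))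
      = norm ((LINT x|M. v x * cnj (w x)) - (LINT x|M. f i x * cnj (w x)))"
      by (rule norm_minus_commute)
    also have "(LINT x|M. v x * cnj (w x)) - (LINT x|M. f i x * cnj (w x))
      = (LINT x|M. (v x - f i x) * cnj (w x))"
      using assms by (simp add: square_integrable_mult_cnj left_diff_distrib)
    finally show "norm ((LINT x|M. f i x * cnj (w x)) - (LINT x|M. v x * cnj (w x))) \<le>
     sqrt (LINT x|M. (cmod (v x - f i x))\<^sup>2) * sqrt (LINT x|M. (cmod (w x))\<^sup>2)"
      using norm_integral_mult_cnj_le[OF square_integrable_diff[OF assms(2,1)] assms(3)] by simp
  qed
  have "((\<lambda>i. sqrt (LINT x|M. (cmod (v x - f i x))\<^sup>2) * sqrt (LINT x|M. (cmod (w x))\<^sup>2)) \<longlongrightarrow>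
     sqrt 0 * sqrt (LINT x|M. (cmod (w x))\<^sup>2)) F"
    by (intro tendsto_intros assms)
  then show "((\<lambda>i. sqrt (LINT x|M. (cmod (v x - f i x))\<^sup>2) * sqrt (LINT x|M. (cmod (w x))\<^sup>2)) \<longlongrightarrow> 0) F"
    by simp
qed

subsection \<open>Series all of whose subsums are square integrable\<close>

text \<open>If a difference is large in norm, one of the two functions is; the two factors 2 add up
  to the 4 in the condensation argument below.\<close>

lemma nn_integral_norm_diff_square_le:
  assumes [measurable]: "f \<in> borel_measurable M" "g \<in> borel_measurable M"
  shows "(\<integral>\<^sup>+x. ennreal ((cmod (f x - g x))\<^sup>2) \<partial>M) \<le>
    2 * (\<integral>\<^sup>+x. ennreal ((cmod (f x))\<^sup>2) \<partial>M) + 2 * (\<integral>\<^sup>+x. ennreal ((cmod (g x))\<^sup>2) \<partial>M)"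
proof -
  have "(cmod (f x - g x))\<^sup>2 \<le> 2 * (cmod (f x))\<^sup>2 + 2 * (cmod (g x))\<^sup>2" for x
  proof -
    have "(cmod (f x - g x))\<^sup>2 \<le> (cmod (f x) + cmod (g x))\<^sup>2"
      by (intro power_mono norm_triangle_ineq4) auto
    moreover have "0 \<le> (cmod (f x) - cmod (g x))\<^sup>2" by simp
    ultimately show ?thesis by (simp add: power2_diff power2_sum)
  qed
  then have "(\<integral>\<^sup>+x. ennreal ((cmod (f x - g x))\<^sup>2) \<partial>M) \<le>
    (\<integral>\<^sup>+x. 2 * ennreal ((cmod (f x))\<^sup>2) + 2 * ennreal ((cmod (g x))\<^sup>2) \<partial>M)"
    by (intro nn_integral_mono)
      (auto simp flip: ennreal_plus ennreal_numeral ennreal_mult' intro!: ennreal_leI)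
  also have "\<dots> = 2 * (\<integral>\<^sup>+x. ennreal ((cmod (f x))\<^sup>2) \<partial>M) + 2 * (\<integral>\<^sup>+x. ennreal ((cmod (g x))\<^sup>2) \<partial>M)"
    by (simp add: nn_integral_add nn_integral_cmult)
  finally show ?thesis .
qed

text \<open>
  A condensation argument on the Cantor space of subsets of the naturals: by Fatou's lemma the
  sets of subsets \<open>B\<close> whose sum has norm at most \<open>N\<close> are closed, so if the terms were unbounded
  in norm one could build a subset whose sum has infinite norm.
\<close>

lemma bounded_terms_of_square_integrable_subsums:
  fixes h :: "nat \<Rightarrow> 'a \<Rightarrow> complex"
  assumes meas[measurable]: "\<And>j. h j \<in> borel_measurable M"
    and summ: "AE x in M. summable (\<lambda>j. cmod (h j x))"
    and fin: "\<And>B. (\<integral>\<^sup>+x. ennreal ((cmod (\<Sum>j. if j \<in> B then h j x else 0))\<^sup>2) \<partial>M) < \<infinity>"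
  shows "\<exists>C. \<forall>j. (\<integral>\<^sup>+x. ennreal ((cmod (h j x))\<^sup>2) \<partial>M) \<le> ennreal C"
proof (rule ccontr)
  define F where "F B x = (\<Sum>j. if j \<in> B then h j x else 0)" for B x
  define I where "I B = (\<integral>\<^sup>+x. ennreal ((cmod (F B x))\<^sup>2) \<partial>M)" for B
  have [measurable]: "F B \<in> borel_measurable M" for B
    unfolding F_def by measurable
  have Ifin: "I B < \<infinity>" for B using fin[of B] by (simp add: I_def F_def)
  define n where "n j = (\<integral>\<^sup>+x. ennreal ((cmod (h j x))\<^sup>2) \<partial>M)" for j
  assume "\<not> ?thesis"
  then have unb: "\<exists>j. n j > ennreal C" for C by (auto simp: n_def not_le)
  have F_single: "F {j} = h j" for j
  proof
    fix x
    show "F {j} x = h j x"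
      unfolding F_def using suminf_finite[of "{j}" "\<lambda>i. if i \<in> {j} then h i x else 0"] by simp
  qed
  have nfin: "n j < \<infinity>" for j
    using Ifin[of "{j}"] by (simp add: I_def n_def F_single)
  have unbL: "\<exists>j\<ge>L. n j > ennreal C" for C L
  proof -
    \<comment> \<open>Each single norm is finite, so a term beating all of the first
      \<open>L\<close> terms can be found; its index is at least \<open>L\<close>.\<close>
    define C' where "C' = max C (\<Sum>j<L. enn2real (n j))"
    obtain j where j: "n j > ennreal C'" using unb by blast
    have "j \<ge> L"
    proof (rule ccontr)
      assume "\<not> j \<ge> L"
      then have "enn2real (n j) \<le> (\<Sum>j<L. enn2real (n j))"
        by (intro member_le_sum) auto
      then have "ennreal (enn2real (n j)) \<le> ennreal C'"
        by (intro ennreal_leI) (simp add: C'_def)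
      then show False using j nfin[of j] by (simp add: ennreal_enn2real_if not_less split: if_splits)
    qed
    moreover have "ennreal C \<le> ennreal C'" by (intro ennreal_leI) (simp add: C'_def)
    ultimately show ?thesis using j by (meson le_less_trans)
  qed
  have fsum: "summable (\<lambda>j. if j \<in> B then h j x else 0)" if "summable (\<lambda>j. cmod (h j x))" for B x
    by (rule summable_comparison_test'[OF that]) auto
  have Fatou: "\<exists>L'. \<forall>D. D \<inter> {..<L'} = B \<inter> {..<L'} \<longrightarrow> I D > c" if "I B > c" for B c
  proof (rule ccontr)
    assume "\<not> ?thesis"
    then have "\<forall>L. \<exists>D. D \<inter> {..<L} = B \<inter> {..<L} \<and> I D \<le> c" by (simp add: not_less)
    \<comment> \<open>A counterexample is a sequence of sets converging to \<open>B\<close> in the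
      Cantor space whose norms stay at most \<open>c\<close>.\<close>
    then obtain D where D: "\<And>L. D L \<inter> {..<L} = B \<inter> {..<L}" "\<And>L. I (D L) \<le> c"
      by metis
    have lim: "(\<lambda>L. F (D L) x) \<longlonglongrightarrow> F B x" if s: "summable (\<lambda>j. cmod (h j x))" for x
    proof (rule Lim_null[THEN iffD2], rule Lim_null_comparison)
      show "(\<lambda>L. \<Sum>j. cmod (h (j + L) x)) \<longlonglongrightarrow> 0"
        by (rule suminf_exist_split2[OF s])
      show "\<forall>\<^sub>F L in sequentially. norm (F (D L) x - F B x) \<le> (\<Sum>j. cmod (h (j + L) x))"
      proof (intro always_eventually allI)
        fix L
        \<comment> \<open>The two subseries agree below \<open>L\<close>, so their difference is
          dominated by a tail of the absolutely convergent series.\<close>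
        define d where "d j = (if j \<in> D L then h j x else 0) - (if j \<in> B then h j x else 0)" for j
        have dz: "d j = 0" if "j < L" for j
          using D(1)[of L] that by (auto simp: d_def)
        have ds: "summable d" unfolding d_def by (intro summable_diff fsum s)
        have le: "cmod (d j) \<le> cmod (h j x)" for j by (simp add: d_def)
        have "F (D L) x - F B x = suminf d"
          unfolding F_def d_def by (intro suminf_diff fsum s)
        also have "\<dots> = (\<Sum>j. d (j + L))"
          using suminf_split_initial_segment[OF ds, of L] dz by simp
        finally have "norm (F (D L) x - F B x) = norm (\<Sum>j. d (j + L))" by simp
        also have "\<dots> \<le> (\<Sum>j. cmod (h (j + L) x))"
        proof -
          have s': "summable (\<lambda>j. cmod (h (j + L) x))" by (rule summable_ignore_initial_segment[OF s])
          have ds': "summable (\<lambda>j. cmod (d (j + L)))"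
            by (rule summable_comparison_test'[OF s']) (use le in auto)
          show ?thesis
            by (rule order_trans[OF summable_norm[OF ds'] suminf_le[OF _ ds' s']]) (rule le)
        qed
        finally show "norm (F (D L) x - F B x) \<le> (\<Sum>j. cmod (h (j + L) x))" .
      qed
    qed
    have "I B \<le> (\<integral>\<^sup>+x. liminf (\<lambda>L. ennreal ((cmod (F (D L) x))\<^sup>2)) \<partial>M)"
      unfolding I_def
    proof (rule nn_integral_mono_AE, use summ in eventually_elim)
      case (elim x)
      have *: "(\<lambda>L. ennreal ((cmod (F (D L) x))\<^sup>2)) \<longlonglongrightarrow> ennreal ((cmod (F B x))\<^sup>2)"
        by (intro tendsto_intros tendsto_ennrealI lim elim)
      then show ?case by (subst lim_imp_Liminf[OF _ *]) auto
    qed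
    also have "\<dots> \<le> liminf (\<lambda>L. I (D L))"
      unfolding I_def by (rule nn_integral_liminf) measurable
    also have "\<dots> \<le> liminf (\<lambda>L::nat. c)"
      by (rule Liminf_mono) (simp add: D(2))
    finally show False using that by (simp add: Liminf_const not_less)
  qed
  have step: "\<exists>L' B'. L < L' \<and> B' \<inter> {..<L} = B \<inter> {..<L} \<and>
      (\<forall>D. D \<inter> {..<L'} = B' \<inter> {..<L'} \<longrightarrow> I D > ennreal c)" if c: "c \<ge> 0" for L B c
  proof -
    \<comment> \<open>Adding \<open>j\<close> to a set not containing it changes the sum by
      \<open>h j\<close>. If its norm is above \<open>4 * c\<close>, the set with \<open>j\<close>
      or the one without exceeds \<open>c\<close>. Cutting \<open>B\<close> at \<open>L\<close>
      makes \<open>j\<close> new and preserves the prefix.\<close>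
    obtain j where j: "j \<ge> L" "n j > ennreal (4 * c)" using unbL by blast
    define B0 where "B0 = B \<inter> {..<L}"
    have "AE x in M. F (insert j B0) x - F B0 x = h j x"
      using summ
    proof eventually_elim
      case (elim x)
      have "F (insert j B0) x - F B0 x = F {j} x"
        unfolding F_def suminf_diff[OF fsum[OF elim] fsum[OF elim], of "insert j B0" B0]
        by (intro suminf_cong) (use j in \<open>auto simp: B0_def\<close>)
      then show ?case by (simp add: F_single)
    qed
    then have "n j = (\<integral>\<^sup>+x. ennreal ((cmod (F (insert j B0) x - F B0 x))\<^sup>2) \<partial>M)"
      unfolding n_def by (intro nn_integral_cong_AE) auto
    also have "\<dots> \<le> 2 * I (insert j B0) + 2 * I B0"
      unfolding I_def by (rule nn_integral_norm_diff_square_le) auto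
    finally have *: "ennreal (4 * c) < 2 * I (insert j B0) + 2 * I B0" using j(2) by simp
    have "\<exists>B'. B' \<inter> {..<L} = B \<inter> {..<L} \<and> I B' > ennreal c"
    proof (cases "I B0 > ennreal c")
      case True
      then show ?thesis by (intro exI[of _ B0]) (auto simp: B0_def)
    next
      case False
      have "I (insert j B0) > ennreal c"
      proof (rule ccontr)
        assume "\<not> I (insert j B0) > ennreal c"
        then have "2 * I (insert j B0) + 2 * I B0 \<le> 2 * ennreal c + 2 * ennreal c"
          using False by (intro add_mono mult_left_mono) auto
        also have "\<dots> = ennreal (4 * c)"
          using c by (simp flip: ennreal_plus ennreal_numeral ennreal_mult')
        finally show False using * by simp
      qed
      then show ?thesis using j(1) by (intro exI[of _ "insert j B0"]) (auto simp: B0_def)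
    qed
    then obtain B' where B': "B' \<inter> {..<L} = B \<inter> {..<L}" "I B' > ennreal c" by blast
    from Fatou[OF B'(2)] obtain L' where
      L': "\<forall>D. D \<inter> {..<L'} = B' \<inter> {..<L'} \<longrightarrow> I D > ennreal c" by blast
    \<comment> \<open>Adding \<open>Suc L\<close> makes the prefix strictly longer than
      \<open>L\<close>.\<close>
    have "\<forall>D. D \<inter> {..<L' + Suc L} = B' \<inter> {..<L' + Suc L} \<longrightarrow> I D > ennreal c"
    proof (intro allI impI)
      fix D assume "D \<inter> {..<L' + Suc L} = B' \<inter> {..<L' + Suc L}"
      then have "D \<inter> {..<L' + Suc L} \<inter> {..<L'} = B' \<inter> {..<L' + Suc L} \<inter> {..<L'}" by (rule arg_cong)
      moreover have "{..<L' + Suc L} \<inter> {..<L'} = {..<L'}" by auto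
      ultimately have "D \<inter> {..<L'} = B' \<inter> {..<L'}" by (simp only: Int_assoc)
      then show "I D > ennreal c" using L' by blast
    qed
    then show ?thesis using B'(1) by (intro exI[of _ "L' + Suc L"] exI[of _ B']) auto
  qed
  \<comment> \<open>A pair is a prefix length and a set that fixes this prefix. The guard
    \<open>N > 0\<close> lets the recursion start from any pair.\<close>
  define P where "P N p \<longleftrightarrow> (\<forall>D. D \<inter> {..<fst p} = snd p \<inter> {..<fst p} \<longrightarrow> (N > 0 \<longrightarrow> I D > ennreal (real N)))"
    for N and p :: "nat \<times> nat set"
  define Q where "Q p p' \<longleftrightarrow> fst p < fst p' \<and> snd p' \<inter> {..<fst p} = snd p \<inter> {..<fst p}"
    for p p' :: "nat \<times> nat set"
  have "\<exists>f. \<forall>N. P N (f N) \<and> Q (f N) (f (Suc N))"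
  proof (rule dependent_nat_choice[where P = P and Q = "\<lambda>_. Q"])
    show "\<exists>p. P 0 p" by (auto simp: P_def)
    fix p N assume "P N p"
    obtain L' B' where "fst p < L'" "B' \<inter> {..<fst p} = snd p \<inter> {..<fst p}"
        "\<forall>D. D \<inter> {..<L'} = B' \<inter> {..<L'} \<longrightarrow> I D > ennreal (real (Suc N))"
      using step[of "real (Suc N)" "fst p" "snd p"] by auto
    then show "\<exists>p'. P (Suc N) p' \<and> Q p p'"
      unfolding P_def Q_def by (intro exI[of _ "(L', B')"]) (simp del: of_nat_Suc)
  qed
  then obtain f where f: "\<And>N. P N (f N)" "\<And>N. Q (f N) (f (Suc N))" by blast
  define L where "L N = fst (f N)" for N
  define B where "B N = snd (f N)" for N
  have BL: "B (Suc N) \<inter> {..<L N} = B N \<inter> {..<L N}" "L N < L (Suc N)" for N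
    using f(2)[of N] by (auto simp: Q_def B_def L_def)
  have Lmono: "L N \<le> L N'" if "N \<le> N'" for N N'
    using BL(2) that by (simp add: lift_Suc_mono_le less_imp_le)
  have ext: "N \<le> N' \<Longrightarrow> B N' \<inter> {..<L N} = B N \<inter> {..<L N}" for N N'
  proof (induction N' rule: dec_induct)
    case (step m)
    have "B (Suc m) \<inter> {..<L m} \<inter> {..<L N} = B m \<inter> {..<L m} \<inter> {..<L N}" using BL(1) by simp
    moreover have "{..<L m} \<inter> {..<L N} = {..<L N}" using Lmono[OF step(1)] by auto
    ultimately show ?case using step by (simp add: Int_assoc)
  qed simp
  \<comment> \<open>The limit of the nested prefixes. It inherits every bound secured on the way, so
    its norm exceeds every natural number.\<close>
  define D where "D = (\<Union>N. B N \<inter> {..<L N})"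
  have DN: "D \<inter> {..<L N} = B N \<inter> {..<L N}" for N
  proof (intro set_eqI iffI)
    fix j assume "j \<in> D \<inter> {..<L N}"
    then obtain m where m: "j \<in> B m" "j < L m" "j < L N" by (auto simp: D_def)
    show "j \<in> B N \<inter> {..<L N}"
    proof (cases "N \<le> m")
      case True then show ?thesis using ext[OF True] m by auto
    next
      case False then show ?thesis using ext[of m N] m by auto
    qed
  qed (auto simp: D_def)
  have "I D > ennreal (real N)" if "N > 0" for N
    using f(1)[of N] DN[of N] that by (simp add: P_def B_def L_def)
  moreover obtain r where r: "I D = ennreal r" "r \<ge> 0"
    using Ifin[of D] by (cases "I D") auto
  moreover obtain N :: nat where N: "r < real N" using reals_Archimedean2 by blast
  moreover have "N > 0" using N r(2) by (cases N) auto
  ultimately have "ennreal (real N) < ennreal r" by metis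
  then show False using N r(2) by (simp add: ennreal_less_iff)
qed

subsection \<open>Characters of the torus\<close>

lemma of_lattice_nth [simp]: "of_lattice k $ i = real_of_int (k $ i)"
  by (simp add: of_lattice_def)

lemma of_lattice_add: "of_lattice (k + m) = of_lattice k + of_lattice m"
  by (simp add: vec_eq_iff)

lemma of_lattice_uminus: "of_lattice (- k) = - of_lattice k"
  by (simp add: vec_eq_iff)

lemma of_lattice_zero [simp]: "of_lattice 0 = 0"
  by (simp add: vec_eq_iff)

lemma of_lattice_axis: "of_lattice (axis i 1) = axis i 1"
  by (simp add: vec_eq_iff axis_def)

lemma ch_add: "ch (k + m) x = ch k x * ch m x"
  by (simp add: ch_def of_lattice_add inner_add_left exp_add [symmetric] algebra_simps)

lemma ch_zero [simp]: "ch 0 x = 1"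
  by (simp add: ch_def)

lemma ch_uminus: "ch (- k) x = cnj (ch k x)"
  by (simp add: ch_def of_lattice_uminus exp_cnj)

lemma norm_ch [simp]: "cmod (ch k x) = 1"
  by (simp add: ch_def norm_exp_eq_Re)

lemma ch_mult_cnj: "ch k x * cnj (ch m x) = ch (k - m) x"
  using ch_add[of k "- m" x] by (simp add: ch_uminus)

lemma ch_shift: "ch k (x + y) = ch k x * ch k y"
  by (simp add: ch_def inner_add_right exp_add [symmetric] algebra_simps)

lemma ch_of_lattice [simp]: "ch k (of_lattice m) = 1"
proof -
  define S where "S = (\<Sum>i\<in>UNIV. k $ i * m $ i)"
  have "of_lattice k \<bullet> of_lattice m = real_of_int S"
    by (simp add: inner_vec_def S_def)
  then show ?thesis
    using exp_two_pi_i[THEN arg_cong, of "\<lambda>z. z powi S"]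
    by (simp add: ch_def exp_power_int mult_ac)
qed

lemma periodic_ch: "periodic (ch k)"
  by (simp add: periodic_def ch_shift)

lemma continuous_on_ch [continuous_intros]:
  "continuous_on S f \<Longrightarrow> continuous_on S (\<lambda>x. ch k (f x))"
  unfolding ch_def by (intro continuous_intros)

lemma ch_has_derivative:
  "(ch k has_derivative (\<lambda>h. 2 * of_real pi * \<i> * of_real (of_lattice k \<bullet> h) * ch k x)) (at x within S)"
proof -
  have "((\<lambda>x. 2 * of_real pi * \<i> * of_real (of_lattice k \<bullet> x)) has_derivative
      (\<lambda>h. 2 * of_real pi * \<i> * complex_of_real (of_lattice k \<bullet> h))) (at x within S)"
    by (intro has_derivative_mult_right has_derivative_of_real has_derivative_inner_right has_derivative_ident)
  from has_derivative_compose[OF this DERIV_exp[unfolded has_field_derivative_def]]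
  show ?thesis by (simp add: ch_def [abs_def] mult_ac)
qed

lemma periodic_mult: "periodic v \<Longrightarrow> periodic w \<Longrightarrow> periodic (\<lambda>x. v x * w x)"
  by (simp add: periodic_def)

lemma periodic_axis: "periodic w \<Longrightarrow> w (x + axis i 1) = w x"
  unfolding periodic_def by (metis of_lattice_axis)

section \<open>Integration over the cube and orthonormality of the characters\<close>

lemma integrable_torus_continuous:
  assumes "continuous_on (cbox 0 1) v"
  shows "integrable torus (v :: real ^ 'n \<Rightarrow> 'b :: euclidean_space)"
  using absolutely_integrable_continuous[OF assms]
  by (simp add: integrable_restrict_space set_integrable_def)

lemma integral_torus_continuous:
  assumes "continuous_on (cbox 0 1) v"
  shows "(LINT x|torus. v x) = integral (cbox 0 1) (v :: real ^ 'n \<Rightarrow> complex)"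
  by (rule lebesgue_integral_eq_integral) (auto intro: integrable_torus_continuous assms)

lemma square_integrable_torus_continuous:
  assumes "continuous_on (cbox 0 1) v"
  shows "square_integrable torus v"
proof -
  have "integrable torus (\<lambda>x. (cmod (v x))\<^sup>2)"
    by (intro integrable_torus_continuous continuous_intros assms)
  then show ?thesis
    using borel_measurable_integrable[OF integrable_torus_continuous[OF assms]]
    by (simp add: square_integrable_def)
qed

lemma square_integrable_ch: "square_integrable torus (ch k)"
  by (intro square_integrable_torus_continuous continuous_intros)

lemma ch_measurable [measurable]: "ch k \<in> borel_measurable torus"
  using square_integrable_ch by (rule square_integrable_measurable)

text \<open>The shifted cube is cut at the face \<open>x $ i = 1\<close>, the protruding slab is
  moved back by one period, and the pieces are glued at height \<open>t\<close>. The bounds on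
  \<open>t\<close> keep the slab within a single period.\<close>

lemma integral_shift_axis_periodic:
  fixes w :: "real ^ 'n \<Rightarrow> complex"
  assumes per: "periodic w" and cont: "continuous_on UNIV w" and t: "0 \<le> t" "t \<le> 1"
  shows "integral (cbox 0 1) (\<lambda>x. w (x + t *\<^sub>R axis i 1)) = integral (cbox 0 1) w"
proof -
  define e :: "real ^ 'n" where "e = axis i 1"
  define c where "c = t *\<^sub>R e"
  have e: "e \<in> Basis" by (auto simp: e_def Basis_vec_def)
  have int: "w integrable_on cbox a b" for a b
    by (intro integrable_continuous continuous_on_subset[OF cont]) auto
  have xe: "x \<bullet> e = x $ i" for x by (simp add: e_def inner_axis)
  have box: "x \<in> cbox a b \<longleftrightarrow> (a $ i \<le> x $ i \<and> x $ i \<le> b $ i) \<and>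
      (\<forall>j. j \<noteq> i \<longrightarrow> a $ j \<le> x $ j \<and> x $ j \<le> b $ j)" for a b x :: "real ^ 'n"
    unfolding mem_box_cart by metis
  have en: "e $ j = (if j = i then 1 else 0)" for j by (simp add: e_def axis_def)
  have "integral (cbox 0 1) (\<lambda>x. w (x + c)) = integral (cbox 0 1) (w \<circ> ((+) c))"
    by (simp add: o_def add.commute)
  also have "\<dots> = integral (cbox c (1 + c)) w"
    by (simp add: integral_shift_cbox_plus)
  also have "\<dots> = integral (cbox c (1 + c) \<inter> {x. x \<bullet> e \<le> 1}) w
      + integral (cbox c (1 + c) \<inter> {x. x \<bullet> e \<ge> 1}) w"
    by (rule integral_split[OF int e])
  also have "cbox c (1 + c) \<inter> {x. x \<bullet> e \<le> 1} = cbox c 1"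
    using t by (auto simp: box xe c_def en)
  also have "cbox c (1 + c) \<inter> {x. x \<bullet> e \<ge> 1} = cbox (0 + e) ((1 + c - e) + e)"
    using t by (auto simp: box xe c_def en)
  also have "integral (cbox (0 + e) ((1 + c - e) + e)) w = integral (cbox 0 (1 + c - e)) (w \<circ> ((+) e))"
    by (rule integral_shift_cbox_plus[symmetric])
  also have "w \<circ> ((+) e) = w"
    using periodic_axis[OF per] by (auto simp: e_def add.commute)
  also have "integral (cbox c 1) w = integral (cbox 0 1 \<inter> {x. x \<bullet> e \<ge> t}) w"
    using t by (intro arg_cong[where f = "\<lambda>S. integral S w"])
      (auto simp: box xe c_def en)
  also have "integral (cbox 0 (1 + c - e)) w = integral (cbox 0 1 \<inter> {x. x \<bullet> e \<le> t}) w"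
    using t by (intro arg_cong[where f = "\<lambda>S. integral S w"])
      (auto simp: box xe c_def en)
  also have "integral (cbox 0 1 \<inter> {x. x \<bullet> e \<ge> t}) w + integral (cbox 0 1 \<inter> {x. x \<bullet> e \<le> t}) w
      = integral (cbox 0 1) w"
    using integral_split[OF int e, of 0 1 t] by simp
  finally show ?thesis by (simp add: c_def e_def)
qed

text \<open>The integral of a translate is constant in the translation parameter, and it may be
  differentiated under the integral sign. This stands in for integration by parts, both for the
  orthogonality of the characters and for the decay of Fourier coefficients.\<close>

lemma integral_partial_derivative_periodic:
  fixes w :: "real ^ 'n \<Rightarrow> complex"
  assumes per: "periodic w"
    and der: "\<And>x. (w has_derivative w' x) (at x)"
    and cont: "continuous_on UNIV (\<lambda>x. w' x (axis i 1))"
  shows "(LINT x|torus. w' x (axis i 1)) = 0"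
proof -
  define e :: "real ^ 'n" where "e = axis i 1"
  have contw: "continuous_on UNIV w"
    using der by (intro continuous_at_imp_continuous_on) (auto intro: has_derivative_continuous)
  have cont': "continuous_on S (\<lambda>x. w' (f x) e)" if "continuous_on S f" for S and f :: "_ \<Rightarrow> real^'n"
    using continuous_on_compose2[OF cont that] by (simp add: e_def)
  \<comment> \<open>One-sided at 0, because translation invariance is available for parameters in
    the unit interval.\<close>
  have d: "((\<lambda>t. integral (cbox 0 1) (\<lambda>x. w (x + t *\<^sub>R e))) has_vector_derivative
      integral (cbox 0 1) (\<lambda>x. w' (x + 0 *\<^sub>R e) e)) (at 0 within {0..1::real})"
  proof (rule leibniz_rule_vector_derivative)
    fix t :: real and x :: "real ^ 'n"
    have "((\<lambda>t. x + t *\<^sub>R e) has_derivative (\<lambda>h. h *\<^sub>R e)) (at t within {0..1})"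
      by (auto intro!: derivative_eq_intros)
    from has_derivative_compose[OF this der]
    have "((\<lambda>t. w (x + t *\<^sub>R e)) has_derivative (\<lambda>h. w' (x + t *\<^sub>R e) (h *\<^sub>R e))) (at t within {0..1})" .
    then show "((\<lambda>t. w (x + t *\<^sub>R e)) has_vector_derivative w' (x + t *\<^sub>R e) e) (at t within {0..1})"
      using has_derivative_bounded_linear[OF der, THEN bounded_linear.linear]
      by (simp add: has_vector_derivative_def linear_cmul)
  next
    fix t :: real
    show "(\<lambda>x. w (x + t *\<^sub>R e)) integrable_on cbox 0 1"
      by (intro integrable_continuous continuous_on_compose2[OF contw] continuous_intros) auto
  next
    show "continuous_on ({0..1} \<times> cbox 0 1) (\<lambda>(t, x). w' (x + t *\<^sub>R e) e)"
      unfolding split_beta by (intro cont' continuous_intros)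
  qed auto
  have "integral (cbox 0 1) (\<lambda>x. w (x + t *\<^sub>R e)) = integral (cbox 0 1) w" if "t \<in> {0..1}" for t
    using integral_shift_axis_periodic[OF per contw, of t i] that by (simp add: e_def)
  then have "((\<lambda>t::real. integral (cbox 0 1) w) has_vector_derivative
      integral (cbox 0 1) (\<lambda>x. w' (x + 0 *\<^sub>R e) e)) (at 0 within {0..1::real})"
    by (intro has_vector_derivative_transform[OF _ _ d]) auto
  moreover have "((\<lambda>t::real. integral (cbox 0 1) w) has_vector_derivative 0) (at 0 within {0..1::real})"
    by simp
  ultimately have "integral (cbox 0 1) (\<lambda>x. w' (x + 0 *\<^sub>R e) e) = 0"
    using vector_derivative_unique_within_closed_interval[of 0 1 0 "\<lambda>t::real. integral (cbox 0 1) w"]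
    by auto
  then show ?thesis
    by (subst integral_torus_continuous) (auto simp: e_def intro: continuous_on_subset[OF cont])
qed

text \<open>Differentiation in a direction with \<open>k $ i\<close> nonzero multiplies the
  character by a nonzero constant, while the derivative integrates to 0.\<close>

lemma integral_ch:
  fixes k :: "int ^ 'n"
  shows "(LINT x|torus. ch k x) = (if k = 0 then 1 else 0)"
proof (cases "k = 0")
  case True
  have "measure lebesgue (cbox (0::real^'n) 1) = 1"
    by (simp add: content_cbox_cart interval_ne_empty_cart)
  then show ?thesis using True by (simp add: measure_restrict_space)
next
  case False
  then obtain i where i: "k $ i \<noteq> 0" by (auto simp: vec_eq_iff)
  have "(LINT x|torus. 2 * of_real pi * \<i> * of_real (of_lattice k \<bullet> axis i 1) * ch k x) = 0"
    by (rule integral_partial_derivative_periodic[OF periodic_ch ch_has_derivative])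
      (intro continuous_intros)
  then have "2 * of_real pi * \<i> * of_real (of_lattice k \<bullet> axis i 1) * (LINT x|torus. ch k x) = 0"
    by simp
  then show ?thesis using i False by (simp add: inner_axis)
qed

lemma integral_ch_mult_cnj: "(LINT x|torus. ch k x * cnj (ch m x)) = (if k = m then 1 else 0)"
  by (simp add: ch_mult_cnj integral_ch)

subsection \<open>Bessel and Riesz-Fischer\<close>

text \<open>By monotone convergence the sum of the norms has a finite integral, hence is finite
  almost everywhere. This produces the pointwise limit in Riesz-Fischer.\<close>

lemma AE_summable_if_summable_integral_norm:
  fixes h :: "nat \<Rightarrow> 'a \<Rightarrow> complex"
  assumes int: "\<And>j. integrable M (h j)" and summ: "summable (\<lambda>j. LINT x|M. cmod (h j x))"
  shows "AE x in M. summable (\<lambda>j. cmod (h j x))"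
proof -
  have [measurable]: "h j \<in> borel_measurable M" for j
    by (rule borel_measurable_integrable[OF int])
  have "(\<integral>\<^sup>+x. (\<Sum>j. ennreal (cmod (h j x))) \<partial>M) = (\<Sum>j. \<integral>\<^sup>+x. ennreal (cmod (h j x)) \<partial>M)"
    by (intro nn_integral_suminf) measurable
  also have "\<dots> = (\<Sum>j. ennreal (LINT x|M. cmod (h j x)))"
    using int by (intro suminf_cong nn_integral_eq_integral) auto
  also have "\<dots> \<noteq> \<infinity>"
    by (simp add: suminf_ennreal2[OF _ summ] infinity_ennreal_def)
  finally have "AE x in M. (\<Sum>j. ennreal (cmod (h j x))) \<noteq> \<infinity>"
    by (intro nn_integral_PInf_AE) auto
  then show ?thesis
  proof eventually_elim
    case (elim x)
    then show ?case by (intro summable_suminf_not_top) (auto simp: infinity_ennreal_def)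
  qed
qed

lemma L2_torus_iff: "v \<in> L2_torus \<longleftrightarrow> periodic v \<and> square_integrable torus v"
  by (auto simp: L2_torus_def square_integrable_def)

definition trig_sum :: "(int ^ 'n \<Rightarrow> complex) \<Rightarrow> (int ^ 'n) set \<Rightarrow> real ^ 'n \<Rightarrow> complex"
  where "trig_sum f K x = (\<Sum>k\<in>K. ch (- k) x * f k)"

lemma square_integrable_trig_sum: "square_integrable torus (trig_sum f K)"
proof -
  have "trig_sum f K = (\<lambda>x. \<Sum>k\<in>K. f k * ch (- k) x)"
    by (auto simp: trig_sum_def mult.commute)
  then show ?thesis
    by (simp add: square_integrable_sum square_integrable_cmult square_integrable_ch)
qed

lemma periodic_trig_sum: "periodic (trig_sum f K)"
  by (simp add: periodic_def trig_sum_def ch_shift)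

text \<open>For infinite \<open>K\<close> both sums take the default value 0; this allows rewriting
  under the limit along \<open>finite_subsets_at_top\<close>.\<close>

lemma inner_trig_sum:
  assumes "square_integrable torus w"
  shows "(LINT x|torus. trig_sum f K x * cnj (w x)) = (\<Sum>k\<in>K. f k * cnj (lattice_FT_inv w k))"
proof -
  have int: "integrable torus (\<lambda>x. ch (- k) x * cnj (w x))" for k
    by (intro square_integrable_mult_cnj square_integrable_ch assms)
  have "(LINT x|torus. trig_sum f K x * cnj (w x))
      = (LINT x|torus. (\<Sum>k\<in>K. f k * (ch (- k) x * cnj (w x))))"
    by (simp add: trig_sum_def sum_distrib_left sum_distrib_right mult_ac)
  also have "\<dots> = (\<Sum>k\<in>K. LINT x|torus. f k * (ch (- k) x * cnj (w x)))"
    by (intro Bochner_Integration.integral_sum integrable_mult_right int)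
  also have "\<dots> = (\<Sum>k\<in>K. f k * (LINT x|torus. cnj (ch k x * w x)))"
    by (simp add: ch_uminus)
  finally show ?thesis by (simp add: lattice_FT_inv_def del: complex_cnj_mult)
qed

lemma lattice_FT_inv_trig_sum:
  assumes "finite K"
  shows "lattice_FT_inv (trig_sum f K) k = (if k \<in> K then f k else 0)"
proof -
  have "lattice_FT_inv (trig_sum f K) k = (LINT x|torus. trig_sum f K x * cnj (ch (- k) x))"
    by (simp add: lattice_FT_inv_def ch_uminus mult.commute)
  also have "\<dots> = (\<Sum>m\<in>K. f m * cnj (lattice_FT_inv (ch (- k)) m))"
    by (rule inner_trig_sum[OF square_integrable_ch])
  also have "\<dots> = (\<Sum>m\<in>K. if m = k then f m else 0)"
    by (intro sum.cong) (simp_all add: lattice_FT_inv_def ch_uminus integral_ch_mult_cnj)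
  finally show ?thesis using assms by simp
qed

lemma integral_norm_trig_sum:
  assumes "finite K"
  shows "(LINT x|torus. (cmod (trig_sum f K x))\<^sup>2) = (\<Sum>k\<in>K. (cmod (f k))\<^sup>2)"
proof -
  have "complex_of_real (LINT x|torus. (cmod (trig_sum f K x))\<^sup>2)
      = (LINT x|torus. complex_of_real ((cmod (trig_sum f K x))\<^sup>2))"
    by (rule integral_complex_of_real[symmetric])
  also have "\<dots> = (LINT x|torus. trig_sum f K x * cnj (trig_sum f K x))"
    by (simp only: complex_norm_square)
  also have "\<dots> = (\<Sum>k\<in>K. f k * cnj (f k))"
    by (simp add: inner_trig_sum square_integrable_trig_sum lattice_FT_inv_trig_sum assms)
  also have "\<dots> = complex_of_real (\<Sum>k\<in>K. (cmod (f k))\<^sup>2)"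
    by (simp only: of_real_sum complex_norm_square)
  finally show ?thesis by (simp only: of_real_eq_iff)
qed

text \<open>The squared distance from \<open>w\<close> to its partial sum is the squared norm of
  \<open>w\<close> minus \<open>B\<close>, since both mixed terms and the squared norm of the
  partial sum equal \<open>B\<close>.\<close>

lemma Bessel_inequality:
  assumes w: "square_integrable torus w" and "finite K"
  shows "(\<Sum>k\<in>K. (cmod (lattice_FT_inv w k))\<^sup>2) \<le> (LINT x|torus. (cmod (w x))\<^sup>2)"
proof -
  define S where "S = trig_sum (lattice_FT_inv w) K"
  define B where "B = (\<Sum>k\<in>K. (cmod (lattice_FT_inv w k))\<^sup>2)"
  have S: "square_integrable torus S" unfolding S_def by (rule square_integrable_trig_sum)
  have 1: "(LINT x|torus. S x * cnj (w x)) = complex_of_real B"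
    unfolding S_def B_def inner_trig_sum[OF w] by (simp only: of_real_sum complex_norm_square)
  have "(LINT x|torus. w x * cnj (S x)) = (LINT x|torus. cnj (S x * cnj (w x)))"
    by (simp add: mult.commute)
  also have "\<dots> = complex_of_real B"
    using 1 by (simp only: Bochner_Integration.integral_cnj complex_cnj_complex_of_real)
  finally have 2: "(LINT x|torus. w x * cnj (S x)) = complex_of_real B" .
  have 3: "(LINT x|torus. S x * cnj (S x)) = complex_of_real B"
  proof -
    have "(LINT x|torus. S x * cnj (S x)) = (LINT x|torus. complex_of_real ((cmod (S x))\<^sup>2))"
      by (simp only: complex_norm_square)
    also have "\<dots> = complex_of_real (LINT x|torus. (cmod (S x))\<^sup>2)"
      by (rule integral_complex_of_real)
    finally show ?thesis using assms(2) by (simp add: S_def B_def integral_norm_trig_sum)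
  qed
  have 4: "(LINT x|torus. w x * cnj (w x)) = complex_of_real (LINT x|torus. (cmod (w x))\<^sup>2)"
    by (simp only: integral_complex_of_real[symmetric] complex_norm_square)
  have "complex_of_real (LINT x|torus. (cmod (w x - S x))\<^sup>2)
      = complex_of_real ((LINT x|torus. (cmod (w x))\<^sup>2) - B)"
    unfolding integral_norm_diff_square[OF w S] 1 2 3 4 by simp
  then have "(LINT x|torus. (cmod (w x - S x))\<^sup>2) = (LINT x|torus. (cmod (w x))\<^sup>2) - B"
    by (simp only: of_real_eq_iff)
  moreover have "0 \<le> (LINT x|torus. (cmod (w x - S x))\<^sup>2)" by simp
  ultimately show ?thesis by (simp add: B_def)
qed

lemma lattice_FT_inv_in_l2:
  assumes "square_integrable torus w"
  shows "lattice_FT_inv w \<in> l2_lattice"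
  unfolding l2_lattice_def
  by (intro CollectI nonneg_bdd_above_summable_on bdd_aboveI[of _ "LINT x|torus. (cmod (w x))\<^sup>2"])
    (auto intro!: Bessel_inequality assms)

text \<open>A fast subsequence of the partial sums converges almost everywhere. Fatou's lemma bounds
  the distance of its limit to every partial sum over a large enough finite set, which gives
  convergence along all finite sets and not just along the subsequence.\<close>

theorem Riesz_Fischer:
  fixes f :: "int ^ 'n \<Rightarrow> complex"
  assumes f: "f \<in> l2_lattice"
  shows "\<exists>v. v \<in> L2_torus \<and>
    ((\<lambda>K. LINT x|torus. (cmod (v x - trig_sum f K x))\<^sup>2) \<longlongrightarrow> 0) (finite_subsets_at_top UNIV)"
proof -
  define s where "s K = (\<Sum>k\<in>K. (cmod (f k))\<^sup>2)" for K
  define A where "A = (\<Sum>\<^sub>\<infinity>k. (cmod (f k))\<^sup>2)"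
  have summ: "(\<lambda>k. (cmod (f k))\<^sup>2) summable_on UNIV" using f by (simp add: l2_lattice_def)
  have sA: "s K \<le> A" if "finite K" for K
    unfolding s_def A_def using that by (intro finite_sum_le_infsum summ) auto
  have smono: "s K \<le> s K'" if "K \<subseteq> K'" "finite K'" for K K'
    unfolding s_def using that by (intro sum_mono2) auto
  \<comment> \<open>The rate 1/4 is for squared norms; its square root 1/2 makes the
    \<open>L^1\<close> distances of successive sums summable.\<close>
  have "\<exists>K. finite K \<and> A - s K < (1/4) ^ j" for j :: nat
  proof -
    have "(s \<longlongrightarrow> A) (finite_subsets_at_top UNIV)"
      using summ unfolding A_def s_def has_sum_def [symmetric] by (rule has_sum_infsum)
    then have "eventually (\<lambda>K. dist (s K) A < (1/4) ^ j) (finite_subsets_at_top UNIV)"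
      by (rule tendstoD) simp
    then obtain K where "finite K" "dist (s K) A < (1/4) ^ j"
      unfolding eventually_finite_subsets_at_top by blast
    then show ?thesis by (intro exI[of _ K]) (auto simp: dist_real_def)
  qed
  then obtain K0 where K0: "\<And>j::nat. finite (K0 j)" "\<And>j. A - s (K0 j) < (1/4) ^ j" by metis
  \<comment> \<open>Unions make the sets nested and can only reduce the missing mass.\<close>
  define K where "K j = (\<Union>i\<le>j. K0 i)" for j
  have finK: "finite (K j)" for j using K0(1) by (simp add: K_def)
  have Kmono: "K i \<subseteq> K j" if "i \<le> j" for i j using that by (force simp: K_def)
  have KA: "A - s (K j) \<le> (1/4) ^ j" for j
  proof -
    have "s (K0 j) \<le> s (K j)" by (rule smono) (use finK in \<open>auto simp: K_def\<close>)
    then show ?thesis using K0(2)[of j] by simp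
  qed
  have tail: "(LINT x|torus. (cmod (trig_sum f U x - trig_sum f V x))\<^sup>2) \<le> (1/4) ^ j"
    if "finite U" "finite V" "K j \<subseteq> U" "K j \<subseteq> V" for U V j
  proof -
    \<comment> \<open>Frequencies in both sets cancel, in particular all of \<open>K j\<close>; what
      remains is at most the mass outside \<open>K j\<close>.\<close>
    define c where "c k = (if k \<in> U then f k else 0) - (if k \<in> V then f k else 0)" for k
    have U: "trig_sum f U x = (\<Sum>k\<in>U \<union> V. ch (- k) x * (if k \<in> U then f k else 0))" for x
      unfolding trig_sum_def using that by (intro sum.mono_neutral_cong_left) auto
    have V: "trig_sum f V x = (\<Sum>k\<in>U \<union> V. ch (- k) x * (if k \<in> V then f k else 0))" for x
      unfolding trig_sum_def using that by (intro sum.mono_neutral_cong_left) auto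
    have "trig_sum f U x - trig_sum f V x = trig_sum c (U \<union> V) x" for x
      unfolding U V by (simp add: trig_sum_def c_def right_diff_distrib sum_subtractf)
    then have "(LINT x|torus. (cmod (trig_sum f U x - trig_sum f V x))\<^sup>2)
        = (\<Sum>k\<in>U \<union> V. (cmod (c k))\<^sup>2)"
      using that by (simp add: integral_norm_trig_sum)
    also have "\<dots> = (\<Sum>k\<in>(U \<union> V) - K j. (cmod (c k))\<^sup>2)"
      using that by (intro sum.mono_neutral_right) (auto simp: c_def)
    also have "\<dots> \<le> (\<Sum>k\<in>(U \<union> V) - K j. (cmod (f k))\<^sup>2)"
      by (intro sum_mono power_mono) (auto simp: c_def)
    also have "\<dots> = s (U \<union> V) - s (K j)"
      unfolding s_def using that by (intro sum_diff) auto
    also have "\<dots> \<le> A - s (K j)" using sA[of "U \<union> V"] that by simp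
    finally show ?thesis using KA[of j] by simp
  qed
  define S where "S j = trig_sum f (K j)" for j
  have sqS: "square_integrable torus (S j)" for j
    unfolding S_def by (rule square_integrable_trig_sum)
  have [measurable]: "S j \<in> borel_measurable torus" for j
    by (rule square_integrable_measurable[OF sqS])
  have tS: "(trig_sum f U) \<in> borel_measurable torus" for U
    by (rule square_integrable_measurable[OF square_integrable_trig_sum])
  have L1: "(LINT x|torus. cmod (S (Suc j) x - S j x)) \<le> (1/2) ^ j" for j
  proof -
    \<comment> \<open>The factor \<open>ch 0\<close> is the constant 1 on a space of total mass 1,
      so this bounds the \<open>L^1\<close> norm by the \<open>L^2\<close> norm.\<close>
    have "(LINT x|torus. cmod (S (Suc j) x - S j x) * cmod (ch 0 x)) \<le>
        sqrt (LINT x|torus. (cmod (S (Suc j) x - S j x))\<^sup>2) * sqrt (LINT x|torus. (cmod (ch (0 :: int ^ 'n) x))\<^sup>2)"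
      by (rule integral_norm_mult_le[OF square_integrable_diff[OF sqS sqS] square_integrable_ch])
    also have "(LINT x|torus. (cmod (ch (0 :: int ^ 'n) x))\<^sup>2) = 1"
      using integral_ch[of "0 :: int ^ 'n"] by (simp add: scaleR_conv_of_real)
    also have "(LINT x|torus. (cmod (S (Suc j) x - S j x))\<^sup>2) \<le> (1/4) ^ j"
      unfolding S_def by (intro tail finK Kmono) auto
    also have "sqrt ((1/4) ^ j) = (1/2) ^ j"
      by (simp add: real_sqrt_power real_sqrt_divide)
    finally show ?thesis by simp
  qed
  have "AE x in torus. summable (\<lambda>j. cmod (S (Suc j) x - S j x))"
  proof (rule AE_summable_if_summable_integral_norm)
    show "integrable torus (\<lambda>x. S (Suc j) x - S j x)" for j
      using square_integrable_mult[OF square_integrable_ch[of 0] square_integrable_diff[OF sqS sqS]]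
      by simp
    show "summable (\<lambda>j. LINT x|torus. cmod (S (Suc j) x - S j x))"
      by (rule summable_comparison_test'[of "\<lambda>j. (1/2) ^ j" 0]) (use L1 in auto)
  qed
  then have conv: "AE x in torus. convergent (\<lambda>j. S j x)"
  proof eventually_elim
    case (elim x)
    then have "summable (\<lambda>j. S (Suc j) x - S j x)" by (rule summable_norm_cancel)
    then have "convergent (\<lambda>n. \<Sum>j<n. (S (Suc j) x - S j x))" by (simp add: summable_iff_convergent)
    then have "convergent (\<lambda>n. S n x - S 0 x)" by (simp only: sum_lessThan_telescope[where f = "\<lambda>j. S j x"])
    then have "convergent (\<lambda>n. (S n x - S 0 x) + S 0 x)" by (intro convergent_add convergent_const)
    then show ?case by simp
  qed
  \<comment> \<open>\<open>lim\<close> is evaluated even where the sequence diverges. Since each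
    \<open>S j\<close> is periodic at every point, so is \<open>v\<close>, and not only almost
    everywhere.\<close>
  define v where "v x = lim (\<lambda>j. S j x)" for x
  have [measurable]: "v \<in> borel_measurable torus"
    unfolding v_def by measurable
  have bound: "(\<integral>\<^sup>+x. ennreal ((cmod (v x - trig_sum f U x))\<^sup>2) \<partial>torus) \<le> ennreal ((1/4) ^ j)"
    if U: "finite U" "K j \<subseteq> U" for U j
  proof -
    note tS[measurable]
    have "(\<integral>\<^sup>+x. ennreal ((cmod (v x - trig_sum f U x))\<^sup>2) \<partial>torus) \<le>
        (\<integral>\<^sup>+x. liminf (\<lambda>i. ennreal ((cmod (S i x - trig_sum f U x))\<^sup>2)) \<partial>torus)"
    proof (rule nn_integral_mono_AE, use conv in eventually_elim)
      case (elim x)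
      then have "(\<lambda>i. S i x) \<longlonglongrightarrow> v x" by (simp add: v_def convergent_LIMSEQ_iff)
      then have *: "(\<lambda>i. ennreal ((cmod (S i x - trig_sum f U x))\<^sup>2)) \<longlonglongrightarrow>
          ennreal ((cmod (v x - trig_sum f U x))\<^sup>2)"
        by (intro tendsto_ennrealI tendsto_intros)
      show ?case by (subst lim_imp_Liminf[OF _ *]) auto
    qed
    also have "\<dots> \<le> liminf (\<lambda>i. \<integral>\<^sup>+x. ennreal ((cmod (S i x - trig_sum f U x))\<^sup>2) \<partial>torus)"
      by (rule nn_integral_liminf) measurable
    also have "\<dots> \<le> liminf (\<lambda>i::nat. ennreal ((1/4) ^ j))"
    proof (rule Liminf_mono, rule eventually_sequentiallyI[of j])
      fix i assume "j \<le> i"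
      have "(\<integral>\<^sup>+x. ennreal ((cmod (S i x - trig_sum f U x))\<^sup>2) \<partial>torus)
          = ennreal (LINT x|torus. (cmod (S i x - trig_sum f U x))\<^sup>2)"
        by (intro nn_integral_eq_integral square_integrable_integrable square_integrable_diff
            sqS square_integrable_trig_sum) auto
      also have "\<dots> \<le> ennreal ((1/4) ^ j)"
        unfolding S_def by (intro ennreal_leI tail finK Kmono U \<open>j \<le> i\<close>)
      finally show "(\<integral>\<^sup>+x. ennreal ((cmod (S i x - trig_sum f U x))\<^sup>2) \<partial>torus) \<le> ennreal ((1/4) ^ j)" .
    qed
    also have "\<dots> = ennreal ((1/4) ^ j)" by (simp add: Liminf_const)
    finally show ?thesis .
  qed
  \<comment> \<open>\<open>v\<close> is a partial sum plus a function of norm at most 1, hence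
    itself square integrable.\<close>
  have sqd: "square_integrable torus (\<lambda>x. v x - trig_sum f (K 0) x)"
    unfolding square_integrable_def
  proof
    note tS[measurable]
    show "(\<lambda>x. v x - trig_sum f (K 0) x) \<in> borel_measurable torus" by measurable
    show "integrable torus (\<lambda>x. (cmod (v x - trig_sum f (K 0) x))\<^sup>2)"
    proof (rule integrableI_bounded)
      have "(\<integral>\<^sup>+x. ennreal (norm ((cmod (v x - trig_sum f (K 0) x))\<^sup>2)) \<partial>torus) \<le> 1"
        using bound[OF finK[of 0], of 0] by simp
      then show "(\<integral>\<^sup>+x. ennreal (norm ((cmod (v x - trig_sum f (K 0) x))\<^sup>2)) \<partial>torus) < \<infinity>"
        by (rule le_less_trans) simp
    qed measurable
  qed
  have sqv: "square_integrable torus v"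
    using square_integrable_add[OF sqd square_integrable_trig_sum[of f "K 0"]] by simp
  have "periodic v"
    using periodic_trig_sum[of f] unfolding periodic_def v_def S_def by simp
  moreover have "((\<lambda>U. LINT x|torus. (cmod (v x - trig_sum f U x))\<^sup>2) \<longlongrightarrow> 0) (finite_subsets_at_top UNIV)"
  proof (rule tendstoI)
    fix e :: real assume "e > 0"
    then obtain j where j: "(1/4 :: real) ^ j < e" using real_arch_pow_inv[of e "1/4"] by auto
    show "\<forall>\<^sub>F U in finite_subsets_at_top UNIV. dist (LINT x|torus. (cmod (v x - trig_sum f U x))\<^sup>2) 0 < e"
      unfolding eventually_finite_subsets_at_top
    proof (intro exI[of _ "K j"] conjI allI impI finK subset_UNIV)
      fix U :: "(int ^ 'n) set" assume U: "finite U \<and> K j \<subseteq> U \<and> U \<subseteq> UNIV"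
      have "ennreal (LINT x|torus. (cmod (v x - trig_sum f U x))\<^sup>2)
          = (\<integral>\<^sup>+x. ennreal ((cmod (v x - trig_sum f U x))\<^sup>2) \<partial>torus)"
        by (intro nn_integral_eq_integral[symmetric] square_integrable_integrable
            square_integrable_diff sqv square_integrable_trig_sum) auto
      also have "\<dots> \<le> ennreal ((1/4) ^ j)" using bound U by blast
      finally have "(LINT x|torus. (cmod (v x - trig_sum f U x))\<^sup>2) \<le> (1/4) ^ j"
        by (subst (asm) ennreal_le_iff) auto
      moreover have "0 \<le> (LINT x|torus. (cmod (v x - trig_sum f U x))\<^sup>2)" by simp
      ultimately show "dist (LINT x|torus. (cmod (v x - trig_sum f U x))\<^sup>2) 0 < e"
        using j by (simp add: dist_real_def)
    qed
  qed
  ultimately show ?thesis using sqv by (auto simp: L2_torus_iff)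
qed

section \<open>Parseval and inversion for the lattice Fourier transform\<close>

lemma lattice_FT_properties:
  assumes "f \<in> l2_lattice"
  shows lattice_FT_in_L2: "lattice_FT f \<in> L2_torus"
    and lattice_FT_tendsto: "((\<lambda>K. LINT x|torus. (cmod (lattice_FT f x - trig_sum f K x))\<^sup>2) \<longlongrightarrow> 0)
       (finite_subsets_at_top UNIV)"
proof -
  have "lattice_FT f \<in> L2_torus \<and> ((\<lambda>K. LINT x|torus. (cmod (lattice_FT f x - trig_sum f K x))\<^sup>2) \<longlongrightarrow> 0)
       (finite_subsets_at_top UNIV)"
    using someI_ex[OF Riesz_Fischer[OF assms]] unfolding lattice_FT_def trig_sum_def .
  then show "lattice_FT f \<in> L2_torus"
    "((\<lambda>K. LINT x|torus. (cmod (lattice_FT f x - trig_sum f K x))\<^sup>2) \<longlongrightarrow> 0) (finite_subsets_at_top UNIV)"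
    by auto
qed

lemma square_integrable_lattice_FT: "f \<in> l2_lattice \<Longrightarrow> square_integrable torus (lattice_FT f)"
  using lattice_FT_in_L2 by (auto simp: L2_torus_iff)

text \<open>Parseval, from the identity for partial sums by continuity of the inner product.\<close>

lemma has_sum_inner_lattice_FT:
  assumes "f \<in> l2_lattice" "square_integrable torus w"
  shows "((\<lambda>k. f k * cnj (lattice_FT_inv w k)) has_sum inner_torus (lattice_FT f) w) UNIV"
  unfolding has_sum_def inner_torus_def inner_trig_sum[OF assms(2), symmetric]
  by (intro tendsto_integral_mult_cnj square_integrable_trig_sum square_integrable_lattice_FT
      lattice_FT_tendsto assms)

lemma lattice_FT_inv_ch: "lattice_FT_inv (ch (- k)) m = (if m = k then 1 else 0)"
  by (simp add: lattice_FT_inv_def ch_uminus integral_ch_mult_cnj)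

lemma lattice_FT_inv_eq_inner: "lattice_FT_inv v k = inner_torus v (ch (- k))"
  by (simp add: lattice_FT_inv_def inner_torus_def ch_uminus mult.commute)

text \<open>Parseval against the character \<open>ch (- k)\<close>, whose coefficients vanish except
  at \<open>k\<close>.\<close>

lemma lattice_FT_inv_lattice_FT:
  assumes "f \<in> l2_lattice"
  shows "lattice_FT_inv (lattice_FT f) = f"
proof
  fix k
  have 1: "((\<lambda>m. f m * cnj (lattice_FT_inv (ch (- k)) m)) has_sum lattice_FT_inv (lattice_FT f) k) UNIV"
    unfolding lattice_FT_inv_eq_inner[of "lattice_FT f"]
    by (rule has_sum_inner_lattice_FT[OF assms square_integrable_ch])
  have "((\<lambda>m. f m * cnj (lattice_FT_inv (ch (- k)) m)) has_sum (\<Sum>m\<in>{k}. f m)) UNIV"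
    by (rule has_sum_finite_neutralI[where B = "{k}"]) (auto simp: lattice_FT_inv_ch)
  with 1 show "lattice_FT_inv (lattice_FT f) k = f k"
    using has_sum_unique by fastforce
qed

subsection \<open>Completeness of the characters\<close>

text \<open>Generated by monomials and sums instead of finite coefficient families, so that equal
  frequencies in a product need not be collected.\<close>

inductive trig_poly :: "(real ^ 'n \<Rightarrow> complex) \<Rightarrow> bool" where
  ch: "trig_poly (\<lambda>x. c * ch k x)"
| add: "trig_poly p \<Longrightarrow> trig_poly q \<Longrightarrow> trig_poly (\<lambda>x. p x + q x)"

lemma trig_poly_mult_ch: "trig_poly p \<Longrightarrow> trig_poly (\<lambda>x. p x * (c * ch k x))"
proof (induction rule: trig_poly.induct)
  case (ch d m)
  have "(\<lambda>x. d * ch m x * (c * ch k x)) = (\<lambda>x. (d * c) * ch (m + k) x)"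
    by (simp add: ch_add mult_ac)
  then show ?case by (simp add: trig_poly.ch)
qed (simp add: distrib_right trig_poly.add)

lemma trig_poly_mult: "trig_poly q \<Longrightarrow> trig_poly p \<Longrightarrow> trig_poly (\<lambda>x. p x * q x)"
  by (induction rule: trig_poly.induct) (simp_all add: trig_poly_mult_ch distrib_left trig_poly.add)

lemma trig_poly_const: "trig_poly (\<lambda>x. c)"
  using trig_poly.ch[of c 0] by simp

lemma square_integrable_trig_poly: "trig_poly p \<Longrightarrow> square_integrable torus p"
  by (induction rule: trig_poly.induct)
    (simp_all add: square_integrable_cmult square_integrable_ch square_integrable_add)

lemma integral_trig_poly_eq_0:
  assumes "trig_poly p" and w: "square_integrable torus w" and "\<And>k. lattice_FT_inv w k = 0"
  shows "(LINT x|torus. p x * w x) = 0"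
  using assms(1)
proof induction
  case (ch c k)
  then show ?case using assms(3)[of k] by (simp add: lattice_FT_inv_def mult.assoc)
next
  case (add p q)
  then show ?case
    by (simp add: distrib_right square_integrable_mult square_integrable_trig_poly w)
qed

section \<open>Stone-Weierstrass on the torus\<close>

definition torus_embedding :: "real ^ 'n \<Rightarrow> complex ^ 'n"
  where "torus_embedding x = (\<chi> i. ch (axis i 1) x)"

lemma ch_axis: "ch (axis i 1) x = exp (2 * of_real pi * \<i> * of_real (x $ i))"
  by (simp add: ch_def of_lattice_axis inner_axis')

text \<open>Equal exponentials make coordinates differ by integers; within the closed unit cube a
  nonzero difference is 1 or -1, so the points lie on opposite faces.\<close>

lemma torus_embedding_eq:
  assumes "torus_embedding x = torus_embedding y" "x \<in> cbox 0 1" "y \<in> cbox 0 1" "x \<noteq> y"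
  shows "\<exists>i. (x $ i = 0 \<and> y $ i = 1) \<or> (x $ i = 1 \<and> y $ i = 0)"
proof -
  obtain i where i: "x $ i \<noteq> y $ i" using assms(4) by (auto simp: vec_eq_iff)
  have "ch (axis i 1) x = ch (axis i 1) y" using assms(1) by (simp add: torus_embedding_def vec_eq_iff)
  then obtain n :: int where n: "2 * of_real pi * \<i> * complex_of_real (x $ i)
      = 2 * of_real pi * \<i> * of_real (y $ i) + complex_of_real (real_of_int (2 * n) * pi) * \<i>"
    unfolding ch_axis exp_eq by blast
  then have "(2 * of_real pi * \<i>) * complex_of_real (x $ i)
      = (2 * of_real pi * \<i>) * (of_real (y $ i) + of_int n)"
    by (simp add: distrib_left mult_ac)
  then have "complex_of_real (x $ i) = of_real (y $ i) + of_int n"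
    by (subst (asm) mult_cancel_left) simp
  then have "complex_of_real (x $ i) = complex_of_real (y $ i + of_int n)" by simp
  then have xy: "x $ i = y $ i + of_int n" by (simp only: of_real_eq_iff)
  have b: "0 \<le> x $ i" "x $ i \<le> 1" "0 \<le> y $ i" "y $ i \<le> 1"
    using assms(2,3) by (auto simp: mem_box_cart)
  have "real_of_int n \<le> 1" "real_of_int n \<ge> -1" using xy b by linarith+
  then have "n = -1 \<or> n = 0 \<or> n = 1" by linarith
  then show ?thesis using xy b i by (intro exI[of _ i]) auto
qed

text \<open>
  A function vanishing on the boundary of the cube factors through \<^const>\<open>torus_embedding\<close>, and on the
  compact image of the cube the Stone-Weierstrass theorem applies.
\<close>

lemma trig_poly_approximation:
  fixes q :: "real ^ 'n \<Rightarrow> real"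
  assumes cont: "continuous_on (cbox 0 1) q"
    and bd: "\<And>x i. x \<in> cbox 0 1 \<Longrightarrow> x $ i = 0 \<or> x $ i = 1 \<Longrightarrow> q x = 0"
    and e: "e > 0"
  shows "\<exists>p. trig_poly p \<and> (\<forall>x\<in>cbox 0 1. cmod (of_real (q x) - p x) < e)"
proof -
  define S where "S = torus_embedding ` cbox (0 :: real ^ 'n) 1"
  have contE: "continuous_on A torus_embedding" for A :: "(real ^ 'n) set"
    unfolding torus_embedding_def by (intro continuous_intros)
  have compS: "compact S"
    unfolding S_def by (intro compact_continuous_image contE compact_cbox)
  have qE: "q x = q y" if xy: "torus_embedding x = torus_embedding y" "x \<in> cbox 0 1" "y \<in> cbox 0 1" for x y
  proof (cases "x = y")
    case False
    then obtain i where "x $ i = 0 \<and> y $ i = 1 \<or> x $ i = 1 \<and> y $ i = 0"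
      using torus_embedding_eq[OF xy False] by blast
    then have "q x = 0" "q y = 0" using bd[OF xy(2), of i] bd[OF xy(3), of i] by auto
    then show ?thesis by simp
  qed simp
  define Q where "Q z = q (SOME x. x \<in> cbox 0 1 \<and> torus_embedding x = z)" for z
  have QE: "Q (torus_embedding x) = q x" if "x \<in> cbox 0 1" for x
  proof -
    have "\<exists>y. y \<in> cbox 0 1 \<and> torus_embedding y = torus_embedding x" using that by blast
    from someI_ex[OF this] show ?thesis unfolding Q_def using that by (intro qE) auto
  qed
  \<comment> \<open>By compactness \<open>torus_embedding\<close> acts as a quotient map: the
    preimage of a closed set under \<open>Q\<close> is the image of its compact preimage under
    \<open>q\<close>.\<close>
  have contQ: "continuous_on S Q"
    unfolding continuous_on_closed_vimage[OF compact_imp_closed[OF compS]]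
  proof (intro allI impI)
    fix B :: "real set" assume "closed B"
    then have "closed (q -` B \<inter> cbox 0 1)"
      using iffD1[OF continuous_on_closed_vimage[OF closed_cbox] cont] by simp
    then have "compact (cbox 0 1 \<inter> (q -` B \<inter> cbox 0 1))" by (intro compact_Int_closed compact_cbox)
    then have "compact (torus_embedding ` (cbox 0 1 \<inter> (q -` B \<inter> cbox 0 1)))"
      by (intro compact_continuous_image contE)
    also have "torus_embedding ` (cbox 0 1 \<inter> (q -` B \<inter> cbox 0 1)) = Q -` B \<inter> S"
    proof (intro set_eqI iffI)
      fix z assume "z \<in> Q -` B \<inter> S"
      then obtain x where "x \<in> cbox 0 1" "z = torus_embedding x" "Q z \<in> B" by (auto simp: S_def)
      then show "z \<in> torus_embedding ` (cbox 0 1 \<inter> (q -` B \<inter> cbox 0 1))" by (auto simp: QE)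
    qed (auto simp: S_def QE)
    finally show "closed (Q -` B \<inter> S)" by (rule compact_imp_closed)
  qed
  \<comment> \<open>Stone-Weierstrass is applied in its real form, so the ring consists of real
    functions whose pullback, read as complex, is a trigonometric polynomial. Real and imaginary
    parts of the coordinates separate points.\<close>
  define R where "R = {G. continuous_on S G \<and> trig_poly (\<lambda>x. complex_of_real (G (torus_embedding x)))}"
  have RI: "G \<in> R" if "continuous_on S G" "trig_poly (\<lambda>x. complex_of_real (G (torus_embedding x)))" for G
    using that by (simp add: R_def)
  have RD: "continuous_on S G" "trig_poly (\<lambda>x. complex_of_real (G (torus_embedding x)))" if "G \<in> R" for G
    using that by (simp_all add: R_def)
  interpret function_ring_on R S
  proof
    show "compact S" by (rule compS)
    show "continuous_on S f" if "f \<in> R" for f using that by (rule RD)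
    show "(\<lambda>x. f x + g x) \<in> R" if "f \<in> R" "g \<in> R" for f g
      using trig_poly.add[OF RD(2)[OF that(1)] RD(2)[OF that(2)]]
        continuous_on_add[OF RD(1)[OF that(1)] RD(1)[OF that(2)]]
      by (intro RI) simp_all
    show "(\<lambda>x. f x * g x) \<in> R" if "f \<in> R" "g \<in> R" for f g
      using trig_poly_mult[OF RD(2)[OF that(2)] RD(2)[OF that(1)]]
        continuous_on_mult[OF RD(1)[OF that(1)] RD(1)[OF that(2)]]
      by (intro RI) simp_all
    show "(\<lambda>_. c) \<in> R" for c
      by (intro RI trig_poly_const continuous_on_const)
  next
    fix z y assume zy: "z \<in> S" "y \<in> S" "z \<noteq> y"
    then obtain i where "z $ i \<noteq> y $ i" by (auto simp: vec_eq_iff)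
    then consider "Re (z $ i) \<noteq> Re (y $ i)" | "Im (z $ i) \<noteq> Im (y $ i)" by (auto simp: complex_eq_iff)
    then show "\<exists>f\<in>R. f z \<noteq> f y"
    proof cases
      case 1
      have "(\<lambda>x. complex_of_real (Re (torus_embedding x $ i)))
          = (\<lambda>x. (1/2) * ch (axis i 1) x + (1/2) * ch (- axis i 1) x)"
        by (rule ext) (simp add: torus_embedding_def ch_uminus complex_eq_iff)
      moreover have "trig_poly \<dots>" by (rule trig_poly.add[OF trig_poly.ch trig_poly.ch])
      ultimately have "(\<lambda>z. Re (z $ i)) \<in> R"
        by (intro RI continuous_on_Re continuous_on_component continuous_on_id) simp
      with 1 show ?thesis by (intro bexI[of _ "\<lambda>z. Re (z $ i)"])
    next
      case 2
      have "(\<lambda>x. complex_of_real (Im (torus_embedding x $ i)))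
          = (\<lambda>x. (- \<i>/2) * ch (axis i 1) x + (\<i>/2) * ch (- axis i 1) x)"
        by (rule ext) (simp add: torus_embedding_def ch_uminus complex_eq_iff)
      moreover have "trig_poly \<dots>" by (rule trig_poly.add[OF trig_poly.ch trig_poly.ch])
      ultimately have "(\<lambda>z. Im (z $ i)) \<in> R"
        by (intro RI continuous_on_Im continuous_on_component continuous_on_id) simp
      with 2 show ?thesis by (intro bexI[of _ "\<lambda>z. Im (z $ i)"])
    qed
  qed
  obtain G where G: "G \<in> R" "\<forall>z\<in>S. \<bar>Q z - G z\<bar> < e"
    using Stone_Weierstrass_basic[OF contQ e] by blast
  have "cmod (of_real (q x) - of_real (G (torus_embedding x))) < e" if "x \<in> cbox 0 1" for x
  proof -
    have "\<bar>q x - G (torus_embedding x)\<bar> < e"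
      using bspec[OF G(2), of "torus_embedding x"] that by (simp add: S_def QE)
    then show ?thesis by (simp flip: of_real_diff)
  qed
  then show ?thesis using RD(2)[OF G(1)] by blast
qed

text \<open>Trigonometric polynomials integrate to 0 against \<open>w\<close>, and replacing
  \<open>q\<close> by one within \<open>e\<close> changes the integral by at most \<open>e\<close>
  times the \<open>L^1\<close> norm of \<open>w\<close>.\<close>

lemma integral_continuous_mult_eq_0:
  fixes q :: "real ^ 'n \<Rightarrow> real"
  assumes cont: "continuous_on (cbox 0 1) q"
    and bd: "\<And>x i. x \<in> cbox 0 1 \<Longrightarrow> x $ i = 0 \<or> x $ i = 1 \<Longrightarrow> q x = 0"
    and w: "square_integrable torus w" and w0: "\<And>k. lattice_FT_inv w k = 0"
  shows "(LINT x|torus. of_real (q x) * w x) = 0"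
proof -
  define C where "C = (LINT x|torus. cmod (w x))"
  have C: "C \<ge> 0" by (simp add: C_def)
  have intw: "integrable torus (\<lambda>x. cmod (w x))"
    using square_integrable_norm_mult[OF square_integrable_ch[of 0] w] by simp
  have sq: "square_integrable torus (\<lambda>x. complex_of_real (q x))"
    by (intro square_integrable_torus_continuous continuous_intros cont)
  have "cmod (LINT x|torus. of_real (q x) * w x) \<le> e * C" if e: "e > 0" for e
  proof -
    have "\<exists>p. trig_poly p \<and> (\<forall>x\<in>cbox 0 1. cmod (of_real (q x) - p x) < e)"
      by (rule trig_poly_approximation[OF cont _ e]) (rule bd)
    then obtain p where p: "trig_poly p"
      "\<And>x. x \<in> cbox 0 1 \<Longrightarrow> cmod (of_real (q x) - p x) < e"
      by blast
    note sp = square_integrable_trig_poly[OF p(1)]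
    have "(LINT x|torus. of_real (q x) * w x) = (LINT x|torus. of_real (q x) * w x) - (LINT x|torus. p x * w x)"
      by (simp add: integral_trig_poly_eq_0[OF p(1) w w0])
    also have "\<dots> = (LINT x|torus. (of_real (q x) - p x) * w x)"
      using square_integrable_mult[OF sq w] square_integrable_mult[OF sp w]
      by (simp add: left_diff_distrib)
    also have "cmod \<dots> \<le> (LINT x|torus. cmod ((of_real (q x) - p x) * w x))"
      by (rule integral_norm_bound)
    also have "\<dots> \<le> (LINT x|torus. e * cmod (w x))"
    proof (rule integral_mono)
      show "integrable torus (\<lambda>x. cmod ((of_real (q x) - p x) * w x))"
        by (intro integrable_norm square_integrable_mult square_integrable_diff sq sp w)
      show "integrable torus (\<lambda>x. e * cmod (w x))" using intw by simp
      show "cmod ((of_real (q x) - p x) * w x) \<le> e * cmod (w x)" if "x \<in> space torus" for x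
        using p(2)[of x] that by (auto simp: norm_mult intro!: mult_right_mono)
    qed
    finally show ?thesis by (simp add: C_def)
  qed
  note le = this
  have "cmod (LINT x|torus. of_real (q x) * w x) \<le> 0"
  proof (rule field_le_epsilon)
    fix e :: real assume "e > 0"
    \<comment> \<open>Dividing by \<open>C + 1\<close> avoids a case distinction on
      \<open>C = 0\<close>.\<close>
    have "cmod (LINT x|torus. of_real (q x) * w x) \<le> e / (C + 1) * C"
      using C \<open>e > 0\<close> by (intro le) simp
    also have "\<dots> \<le> e" using C \<open>e > 0\<close> by (simp add: field_simps)
    finally show "cmod (LINT x|torus. of_real (q x) * w x) \<le> 0 + e" by simp
  qed
  then show ?thesis by simp
qed

text \<open>A measurable function is almost everywhere a limit of continuous ones. Truncating these
  and damping them near the faces keeps the limit in the open cube and makes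
  \<open>integral_continuous_mult_eq_0\<close> applicable; \<open>cmod (w x)\<close>
  dominates.\<close>

lemma integral_bounded_mult_eq_0:
  fixes b :: "real ^ 'n \<Rightarrow> real"
  assumes bm: "b \<in> borel_measurable torus" and b1: "\<And>x. \<bar>b x\<bar> \<le> 1"
    and w: "square_integrable torus w" and w0: "\<And>k. lattice_FT_inv w k = 0"
  shows "(LINT x|torus. of_real (b x) * w x) = 0"
proof -
  have "b measurable_on cbox 0 1"
    using bm by (simp add: measurable_on_iff_borel_measurable)
  then obtain N g where N: "negligible N" and g: "\<And>n. continuous_on UNIV (g n)"
    and lim: "\<And>x. x \<notin> N \<Longrightarrow> (\<lambda>n. g n x) \<longlonglongrightarrow> (if x \<in> cbox 0 1 then b x else 0)"
    unfolding measurable_on_def by blast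
  \<comment> \<open>Positive in the open cube and zero on its faces, so
    \<open>min 1 (real n * d x)\<close> is eventually 1 at every interior point.\<close>
  define d where "d x = (\<Prod>i\<in>UNIV. x $ i * (1 - x $ i))" for x :: "real ^ 'n"
  define q where "q n x = max (-1) (min 1 (g n x)) * min 1 (real n * d x)" for n x
  have cq: "continuous_on (cbox 0 1) (q n)" for n
    unfolding q_def d_def
    by (intro continuous_intros continuous_on_subset[OF g] subset_UNIV)
  have q0: "q n x = 0" if "x $ i = 0 \<or> x $ i = 1" for n x i
  proof -
    have "d x = 0" unfolding d_def using that by (intro prod_zero) auto
    then show ?thesis by (simp add: q_def)
  qed
  have d0: "d x \<ge> 0" if "x \<in> cbox 0 1" for x
    unfolding d_def using that by (intro prod_nonneg) (auto simp: mem_box_cart)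
  have q1: "\<bar>q n x\<bar> \<le> 1" if "x \<in> cbox 0 1" for n x
  proof -
    have "\<bar>q n x\<bar> \<le> 1 * 1"
      unfolding q_def abs_mult using d0[OF that] by (intro mult_mono) auto
    then show ?thesis by simp
  qed
  have limq: "(\<lambda>n. q n x) \<longlonglongrightarrow> b x" if "x \<notin> N" "x \<in> box 0 1" for x
  proof -
    have "d x > 0" unfolding d_def using that by (intro prod_pos) (auto simp: mem_box_cart)
    then obtain n0 :: nat where n0: "1 < real n0 * d x" using reals_Archimedean3 by blast
    have "\<forall>\<^sub>F n in sequentially. min 1 (real n * d x) = 1"
    proof (rule eventually_sequentiallyI[of n0])
      fix n assume "n0 \<le> n"
      then have "real n0 * d x \<le> real n * d x" using \<open>d x > 0\<close> by (intro mult_right_mono) auto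
      then show "min 1 (real n * d x) = 1" using n0 by simp
    qed
    then have 1: "(\<lambda>n. min 1 (real n * d x)) \<longlonglongrightarrow> 1" by (rule tendsto_eventually)
    have "x \<in> cbox 0 1" using that box_subset_cbox by blast
    then have "(\<lambda>n. g n x) \<longlonglongrightarrow> b x" using lim[OF that(1)] by simp
    then have "(\<lambda>n. max (-1) (min 1 (g n x)) * min 1 (real n * d x)) \<longlonglongrightarrow> max (-1) (min 1 (b x)) * 1"
      by (intro tendsto_intros 1)
    moreover have "max (-1) (min 1 (b x)) = b x" using b1[of x] by auto
    ultimately show ?thesis by (simp add: q_def)
  qed
  have "negligible (N \<union> (cbox 0 1 - box 0 1))"
    by (intro negligible_Un N negligible_frontier_interval)
  then have "AE x in lebesgue. x \<notin> N \<union> (cbox 0 1 - box 0 1)"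
    by (intro AE_not_in) (simp add: negligible_iff_null_sets)
  then have "AE x in lebesgue. x \<in> cbox 0 1 \<longrightarrow> (\<lambda>n. q n x) \<longlonglongrightarrow> b x"
    by eventually_elim (use limq in auto)
  then have ae: "AE x in torus. (\<lambda>n. q n x) \<longlonglongrightarrow> b x"
    by (simp add: AE_restrict_space_iff)
  have "(\<lambda>n. LINT x|torus. of_real (q n x) * w x) \<longlonglongrightarrow> (LINT x|torus. of_real (b x) * w x)"
  proof (rule integral_dominated_convergence)
    show "(\<lambda>x. of_real (b x) * w x) \<in> borel_measurable torus"
      using bm square_integrable_measurable[OF w] by measurable
    show "(\<lambda>x. of_real (q n x) * w x) \<in> borel_measurable torus" for n
      by (intro borel_measurable_integrable square_integrable_mult w
          square_integrable_torus_continuous continuous_intros cq)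
    show "integrable torus (\<lambda>x. cmod (w x))"
      using square_integrable_norm_mult[OF square_integrable_ch[of 0] w] by simp
    show "AE x in torus. (\<lambda>n. of_real (q n x) * w x) \<longlonglongrightarrow> of_real (b x) * w x"
      using ae by eventually_elim (intro tendsto_intros)
    show "AE x in torus. cmod (of_real (q n x) * w x) \<le> cmod (w x)" for n
      using q1 by (intro AE_I2) (auto simp: norm_mult intro!: mult_left_le_one_le)
  qed
  moreover have "(LINT x|torus. of_real (q n x) * w x) = 0" for n
    by (rule integral_continuous_mult_eq_0[OF cq q0 w w0])
  ultimately show ?thesis by (simp add: LIMSEQ_const_iff)
qed

text \<open>The sign of \<open>r\<close> is an admissible multiplier and turns the integral into
  that of the absolute value.\<close>

lemma AE_eq_0_if_real_integral_eq_0: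
  fixes r :: "real ^ 'n \<Rightarrow> real"
  assumes r: "integrable torus r"
    and 0: "\<And>b. b \<in> borel_measurable torus \<Longrightarrow> (\<And>x. \<bar>b x\<bar> \<le> 1) \<Longrightarrow> (LINT x|torus. b x * r x) = 0"
  shows "AE x in torus. r x = 0"
proof -
  have [measurable]: "r \<in> borel_measurable torus" by (rule borel_measurable_integrable[OF r])
  have "integrable torus (\<lambda>x. \<bar>r x\<bar>)" using r by simp
  moreover have "(LINT x|torus. sgn (r x) * r x) = 0"
    by (rule 0) (auto simp: sgn_if)
  then have "(LINT x|torus. \<bar>r x\<bar>) = 0" by (simp add: abs_sgn mult.commute)
  ultimately have "AE x in torus. \<bar>r x\<bar> = 0"
    by (subst (asm) integral_nonneg_eq_0_iff_AE) auto
  then show ?thesis by simp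
qed

text \<open>Completeness of the characters. Since the multipliers \<open>b\<close> are real, the
  vanishing complex integral splits into its real and imaginary parts.\<close>

lemma AE_eq_0_if_lattice_FT_inv_eq_0:
  fixes w :: "real ^ 'n \<Rightarrow> complex"
  assumes w: "square_integrable torus w" and w0: "\<And>k. lattice_FT_inv w k = 0"
  shows "AE x in torus. w x = 0"
proof -
  have int: "integrable torus w"
    using square_integrable_mult[OF square_integrable_ch[of 0] w] by simp
  have [measurable]: "w \<in> borel_measurable torus" by (rule square_integrable_measurable[OF w])
  have intb: "integrable torus (\<lambda>x. of_real (b x) * w x)"
    if [measurable]: "b \<in> borel_measurable torus" and "\<And>x. \<bar>b x\<bar> \<le> 1" for b
    by (rule Bochner_Integration.integrable_bound[OF int])
      (use that in \<open>auto simp: norm_mult intro!: mult_left_le_one_le\<close>)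
  have "AE x in torus. Re (w x) = 0"
  proof (rule AE_eq_0_if_real_integral_eq_0)
    fix b :: "real ^ 'n \<Rightarrow> real" assume b: "b \<in> borel_measurable torus" "\<And>x. \<bar>b x\<bar> \<le> 1"
    have "(LINT x|torus. Re (of_real (b x) * w x)) = Re (LINT x|torus. of_real (b x) * w x)"
      by (rule integral_Re[OF intb[OF b]])
    also have "\<dots> = 0" by (simp add: integral_bounded_mult_eq_0[OF b w w0])
    finally show "(LINT x|torus. b x * Re (w x)) = 0" by simp
  qed (use int in simp)
  moreover have "AE x in torus. Im (w x) = 0"
  proof (rule AE_eq_0_if_real_integral_eq_0)
    fix b :: "real ^ 'n \<Rightarrow> real" assume b: "b \<in> borel_measurable torus" "\<And>x. \<bar>b x\<bar> \<le> 1"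
    have "(LINT x|torus. Im (of_real (b x) * w x)) = Im (LINT x|torus. of_real (b x) * w x)"
      by (rule integral_Im[OF intb[OF b]])
    also have "\<dots> = 0" by (simp add: integral_bounded_mult_eq_0[OF b w w0])
    finally show "(LINT x|torus. b x * Im (w x)) = 0" by simp
  qed (use int in simp)
  ultimately show ?thesis by eventually_elim (simp add: complex_eq_iff)
qed

text \<open>The difference of the two sides has vanishing coefficients by inversion on the lattice,
  so completeness applies. Only almost everywhere, since \<open>lattice_FT\<close> picks a
  representative.\<close>

lemma lattice_FT_lattice_FT_inv:
  assumes u: "square_integrable torus u"
  shows "AE x in torus. lattice_FT (lattice_FT_inv u) x = u x"
proof -
  define v where "v = lattice_FT (lattice_FT_inv u)"
  have v: "square_integrable torus v"
    unfolding v_def by (intro square_integrable_lattice_FT lattice_FT_inv_in_l2 u)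
  have "lattice_FT_inv (\<lambda>x. v x - u x) k = 0" for k
  proof -
    have "lattice_FT_inv (\<lambda>x. v x - u x) k = lattice_FT_inv v k - lattice_FT_inv u k"
      unfolding lattice_FT_inv_def right_diff_distrib
      by (intro Bochner_Integration.integral_diff square_integrable_mult square_integrable_ch u v)
    then show ?thesis
      by (simp add: v_def lattice_FT_inv_lattice_FT lattice_FT_inv_in_l2 u)
  qed
  from AE_eq_0_if_lattice_FT_inv_eq_0[OF square_integrable_diff[OF v u] this]
  show ?thesis by eventually_elim (simp add: v_def)
qed

subsection \<open>Smooth functions and rapidly decreasing coefficients\<close>

text \<open>A product over the coordinates, so that the sum of the reciprocals over a box factors
  into one-dimensional sums.\<close>

definition weight :: "int ^ 'n \<Rightarrow> real"
  where "weight k = (\<Prod>i\<in>UNIV. 1 + (real_of_int (k $ i))\<^sup>2)"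

lemma weight_ge_1: "1 \<le> weight k"
  unfolding weight_def by (intro prod_ge_1) auto

lemma weight_pos: "0 < weight k"
  using weight_ge_1[of k] by linarith

lemma abs_coord_le_weight: "\<bar>real_of_int (k $ i)\<bar> \<le> weight k"
proof -
  let ?t = "real_of_int (k $ i)"
  have "\<bar>?t\<bar> \<le> 1 + ?t\<^sup>2"
    using sum_power2_ge_zero[of 0 "\<bar>?t\<bar> - 1/2"] by (simp add: power2_eq_square algebra_simps)
  also have "\<dots> \<le> (1 + ?t\<^sup>2) * (\<Prod>j\<in>UNIV - {i}. 1 + (real_of_int (k $ j))\<^sup>2)"
    using mult_left_mono[OF prod_ge_1, of "UNIV - {i}" "\<lambda>j. 1 + (real_of_int (k $ j))\<^sup>2" "1 + ?t\<^sup>2"]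
    by simp
  also have "\<dots> = weight k"
    unfolding weight_def by (subst prod.remove[of UNIV i]) auto
  finally show ?thesis .
qed

lemma norm_of_lattice_le_weight: "norm (of_lattice (k :: int ^ 'n)) \<le> real CARD('n) * weight k"
proof -
  have "norm (of_lattice k) \<le> (\<Sum>i\<in>UNIV. \<bar>of_lattice k $ i\<bar>)" by (rule norm_le_l1_cart)
  also have "\<dots> \<le> (\<Sum>i\<in>(UNIV :: 'n set). weight k)"
    by (intro sum_mono) (simp add: abs_coord_le_weight)
  finally show ?thesis by simp
qed

text \<open>Each half of the symmetric range is bounded by the one-sided series; counting 0 twice is
  harmless for an upper bound.\<close>

lemma bounded_sums_inverse_one_plus_square:
  "\<exists>B. \<forall>N::nat. (\<Sum>j\<in>{- int N..int N}. 1 / (1 + (real_of_int j)\<^sup>2)) \<le> B"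
proof -
  define h where "h n = 1 / (1 + (real n)\<^sup>2)" for n
  have h_nn: "0 \<le> h n" for n by (simp add: h_def)
  have "summable h"
  proof (rule summable_comparison_test')
    show "summable (\<lambda>n. inverse (real n ^ 2))" by (rule inverse_power_summable) simp
    show "norm (h n) \<le> inverse (real n ^ 2)" if "n \<ge> 1" for n
      using that by (simp add: h_def field_simps add_pos_nonneg)
  qed
  then have le: "(\<Sum>n\<le>N. h n) \<le> suminf h" for N
    by (intro sum_le_suminf) (auto simp add: h_nn)
  have "(\<Sum>j\<in>{- int N..int N}. 1 / (1 + (real_of_int j)\<^sup>2)) \<le> 2 * suminf h" for N
  proof -
    have eq: "{- int N..int N} = int ` {..N} \<union> (\<lambda>n. - int n) ` {..N}"
    proof (intro set_eqI iffI)
      fix j assume j: "j \<in> {- int N..int N}"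
      then show "j \<in> int ` {..N} \<union> (\<lambda>n. - int n) ` {..N}"
      proof (cases "j \<ge> 0")
        case True
        then have "j = int (nat j)" "nat j \<le> N" using j by auto
        then show ?thesis by blast
      next
        case False
        then have "j = - int (nat (- j))" "nat (- j) \<le> N" using j by auto
        then show ?thesis by blast
      qed
    qed auto
    have "(\<Sum>j\<in>{- int N..int N}. 1 / (1 + (real_of_int j)\<^sup>2)) \<le>
        (\<Sum>j\<in>int ` {..N}. 1 / (1 + (real_of_int j)\<^sup>2)) +
        (\<Sum>j\<in>(\<lambda>n. - int n) ` {..N}. 1 / (1 + (real_of_int j)\<^sup>2))"
      unfolding eq by (subst sum_Un) (auto intro!: sum_nonneg)
    also have "\<dots> = (\<Sum>n\<le>N. h n) + (\<Sum>n\<le>N. h n)"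
      by (subst (1 2) sum.reindex) (auto simp: inj_on_def h_def)
    finally show ?thesis using le[of N] by simp
  qed
  then show ?thesis by blast
qed

text \<open>Every finite set of frequencies lies in a box, and over a box the sum factors into
  \<open>CARD('n)\<close> one-dimensional sums, each at most \<open>B\<close>.\<close>

lemma summable_inverse_weight: "(\<lambda>k :: int ^ 'n. 1 / weight k) summable_on UNIV"
proof -
  obtain B where B: "\<And>N::nat. (\<Sum>j\<in>{- int N..int N}. 1 / (1 + (real_of_int j)\<^sup>2)) \<le> B"
    using bounded_sums_inverse_one_plus_square by blast
  have "sum (\<lambda>k. 1 / weight k) K \<le> B ^ CARD('n)" if K: "finite K" for K :: "(int ^ 'n) set"
  proof -
    define N where "N = (\<Sum>k\<in>K. \<Sum>i\<in>UNIV. nat \<bar>k $ i\<bar>)"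
    have N: "k $ i \<in> {- int N..int N}" if "k \<in> K" for k i
    proof -
      have "nat \<bar>k $ i\<bar> \<le> (\<Sum>i\<in>UNIV. nat \<bar>k $ i\<bar>)" by (intro member_le_sum) auto
      also have "\<dots> \<le> N" unfolding N_def
        using member_le_sum[of k K "\<lambda>k. \<Sum>i\<in>UNIV. nat \<bar>k $ i\<bar>"] K that by auto
      finally show ?thesis by auto
    qed
    define P where "P = PiE (UNIV :: 'n set) (\<lambda>_. {- int N..int N})"
    have fP: "finite P" unfolding P_def by (intro finite_PiE) auto
    have "K \<subseteq> vec_lambda ` P"
    proof
      fix k assume "k \<in> K"
      then have "(\<lambda>i. k $ i) \<in> P" using N by (auto simp: P_def)
      then show "k \<in> vec_lambda ` P" by (metis image_eqI vec_nth_inverse)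
    qed
    then have "sum (\<lambda>k. 1 / weight k) K \<le> sum (\<lambda>k. 1 / weight k) (vec_lambda ` P)"
      using fP weight_pos by (intro sum_mono2) (auto intro: less_imp_le)
    also have "\<dots> = (\<Sum>g\<in>P. \<Prod>i\<in>UNIV. 1 / (1 + (real_of_int (g i))\<^sup>2))"
    proof (subst sum.reindex)
      show "inj_on vec_lambda P" by (auto simp: inj_on_def vec_eq_iff)
    qed (simp add: weight_def prod_dividef)
    also have "\<dots> = (\<Prod>i\<in>(UNIV :: 'n set). \<Sum>j\<in>{- int N..int N}. 1 / (1 + (real_of_int j)\<^sup>2))"
      unfolding P_def by (rule prod_sum_PiE[symmetric]) auto
    also have "\<dots> \<le> (\<Prod>i\<in>(UNIV :: 'n set). B)"
      by (intro prod_mono conjI B sum_nonneg) auto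
    finally show ?thesis by simp
  qed
  then show ?thesis
    by (intro nonneg_bdd_above_summable_on bdd_aboveI[of _ "B ^ CARD('n)"])
      (auto simp: less_imp_le[OF weight_pos])
qed

text \<open>Powers of a single weight suffice, because the weight dominates every coordinate and
  hence its powers dominate all polynomials.\<close>

definition rapid :: "(int ^ 'n \<Rightarrow> complex) \<Rightarrow> bool"
  where "rapid a \<longleftrightarrow> (\<forall>r. \<exists>C. \<forall>k. cmod (a k) * weight k ^ r \<le> C)"

text \<open>Multipliers of polynomial growth. They cover differentiation, multiplication by the
  weight and, with \<open>D = 1\<close> and \<open>m = 0\<close>, restriction to a set of
  frequencies.\<close>

lemma rapid_mult:
  fixes a :: "int ^ 'n \<Rightarrow> complex"
  assumes "rapid a" "\<And>k. cmod (b k) \<le> D * weight k ^ m"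
  shows "rapid (\<lambda>k. b k * a k)"
  unfolding rapid_def
proof
  fix r
  obtain C where C: "\<And>k. cmod (a k) * weight k ^ (m + r) \<le> C"
    using assms(1) unfolding rapid_def by blast
  have "0 \<le> D * weight (0 :: int ^ 'n) ^ m" by (rule order_trans[OF norm_ge_zero assms(2)[of 0]])
  moreover have "0 < weight (0 :: int ^ 'n) ^ m" by (rule zero_less_power[OF weight_pos])
  ultimately have D: "D \<ge> 0" by (simp add: zero_le_mult_iff)
  have "cmod (b k * a k) * weight k ^ r \<le> D * C" for k
  proof -
    have "cmod (b k * a k) * weight k ^ r \<le> (D * weight k ^ m) * (cmod (a k) * weight k ^ r)"
      unfolding norm_mult mult.assoc[of "cmod (b k)"]
      by (intro mult_right_mono assms(2)) (use weight_pos[of k] in auto)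
    also have "\<dots> = D * (cmod (a k) * weight k ^ (m + r))" by (simp add: power_add mult_ac)
    also have "\<dots> \<le> D * C" by (intro mult_left_mono C D)
    finally show ?thesis .
  qed
  then show "\<exists>C. \<forall>k. cmod (b k * a k) * weight k ^ r \<le> C" by blast
qed

lemma rapid_summable:
  assumes "rapid a"
  shows "(\<lambda>k. cmod (a k)) summable_on UNIV"
proof -
  obtain C where C: "\<And>k. cmod (a k) * weight k ^ 1 \<le> C"
    using assms unfolding rapid_def by blast
  have "(\<lambda>k. C * (1 / weight k)) summable_on UNIV"
    by (intro summable_on_cmult_right summable_inverse_weight)
  then show ?thesis
  proof (rule summable_on_comparison_test)
    show "cmod (a k) \<le> C * (1 / weight k)" for k
      using C[of k] weight_pos[of k] by (simp add: field_simps)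
  qed auto
qed

lemma rapid_indicator: "rapid (\<lambda>k. if k = m then 1 else 0)"
  unfolding rapid_def
proof
  fix r
  have "cmod (if k = m then 1 else 0) * weight k ^ r \<le> weight m ^ r" for k
    using weight_pos[of m] by simp
  then show "\<exists>C. \<forall>k. cmod (if k = m then 1 else 0) * weight k ^ r \<le> C" by blast
qed

section \<open>Lattice sums as series over the naturals\<close>

definition lattice_enum :: "nat \<Rightarrow> int ^ 'n"
  where "lattice_enum = from_nat_into UNIV"

lemma bij_lattice_enum: "bij (lattice_enum :: nat \<Rightarrow> int ^ 'n)"
proof -
  have "infinite (range (\<lambda>j::nat. (\<chi> i. int j) :: int ^ 'n))"
    by (rule range_inj_infinite) (auto simp: inj_on_def vec_eq_iff)
  then have "infinite (UNIV :: (int ^ 'n) set)" by (rule infinite_super[OF subset_UNIV])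
  then show ?thesis
    unfolding lattice_enum_def by (intro bij_betw_from_nat_into) auto
qed

lemma lattice_enum_surj: "\<exists>j. lattice_enum j = k"
  using bij_is_surj[OF bij_lattice_enum] by (metis surjD)

lemma lattice_enum_eq_iff [simp]: "lattice_enum i = lattice_enum j \<longleftrightarrow> i = j"
  by (rule inj_eq[OF bij_is_inj[OF bij_lattice_enum]])

lemma summable_on_lattice_iff:
  fixes f :: "int ^ 'n \<Rightarrow> complex"
  shows "f summable_on UNIV \<longleftrightarrow> summable (\<lambda>j. cmod (f (lattice_enum j)))"
proof -
  have "f summable_on UNIV \<longleftrightarrow> (\<lambda>k. cmod (f k)) summable_on UNIV"
    by (simp add: summable_on_iff_abs_summable_on_complex)
  also have "\<dots> \<longleftrightarrow> (\<lambda>j. cmod (f (lattice_enum j))) summable_on UNIV"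
    using summable_on_reindex_bij_betw[OF bij_lattice_enum, of "\<lambda>k. cmod (f k)"] by simp
  also have "\<dots> \<longleftrightarrow> summable (\<lambda>j. cmod (f (lattice_enum j)))"
    by (intro summable_on_UNIV_nonneg_real_iff) auto
  finally show ?thesis .
qed

lemma infsum_lattice_sums:
  fixes f :: "int ^ 'n \<Rightarrow> complex"
  assumes "f summable_on UNIV"
  shows "(\<lambda>j. f (lattice_enum j)) sums (\<Sum>\<^sub>\<infinity>k. f k)"
proof -
  have "(f has_sum (\<Sum>\<^sub>\<infinity>k. f k)) UNIV" using assms by (rule has_sum_infsum)
  then have "((\<lambda>j. f (lattice_enum j)) has_sum (\<Sum>\<^sub>\<infinity>k. f k)) UNIV"
    using has_sum_reindex_bij_betw[OF bij_lattice_enum, of f] by simp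
  then show ?thesis by (rule has_sum_imp_sums)
qed

section \<open>Smoothness of Fourier series with rapidly decreasing coefficients\<close>

text \<open>The sign convention is opposite to \<open>trig_sum\<close>: this inverts
  \<open>torus_FT\<close> and is not the lattice transform.\<close>

definition fourier_series :: "(int ^ 'n \<Rightarrow> complex) \<Rightarrow> real ^ 'n \<Rightarrow> complex"
  where "fourier_series a x = (\<Sum>\<^sub>\<infinity>k. ch k x * a k)"

lemma rapid_summable_enum:
  assumes "rapid a"
  shows "summable (\<lambda>j. cmod (a (lattice_enum j)))"
proof -
  have "(\<lambda>k. a k) summable_on UNIV"
    using rapid_summable[OF assms] by (simp add: summable_on_iff_abs_summable_on_complex)
  then show ?thesis by (simp add: summable_on_lattice_iff)
qed

lemma fourier_series_sums:
  assumes "rapid a"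
  shows "(\<lambda>j. ch (lattice_enum j) x * a (lattice_enum j)) sums fourier_series a x"
  unfolding fourier_series_def
  by (rule infsum_lattice_sums) (simp add: summable_on_lattice_iff norm_mult rapid_summable_enum assms)

lemma rapid_coord: "rapid a \<Longrightarrow> rapid (\<lambda>k. 2 * of_real pi * \<i> * of_int (k $ i) * a k)"
  by (rule rapid_mult[where D = "2 * pi" and m = 1])
    (use abs_coord_le_weight in \<open>auto simp: norm_mult\<close>)

text \<open>The termwise derivatives are dominated, uniformly in \<open>x\<close>, by
  \<open>c j * norm h\<close> with summable \<open>c\<close>, as one factor \<open>weight\<close>
  preserves rapid decrease. Along an axis the derivative is again such a series, which drives the
  induction on smoothness.\<close>

lemma fourier_series_has_derivative:
  fixes a :: "int ^ 'n \<Rightarrow> complex"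
  assumes a: "rapid a"
  shows "\<exists>F'. (\<forall>x. (fourier_series a has_derivative F' x) (at x)) \<and>
    (\<forall>x i. F' x (axis i 1) = fourier_series (\<lambda>k. 2 * of_real pi * \<i> * of_int (k $ i) * a k) x)"
proof -
  let ?e = "lattice_enum :: nat \<Rightarrow> int ^ 'n"
  define f where "f j x = ch (?e j) x * a (?e j)" for j x
  define f' where "f' j x h = 2 * of_real pi * \<i> * of_real (of_lattice (?e j) \<bullet> h) * ch (?e j) x * a (?e j)"
    for j x h
  define F' where "F' x h = (\<Sum>j. f' j x h)" for x h
  define c where "c j = cmod (of_real (2 * pi * real CARD('n) * weight (?e j)) * a (?e j))" for j
  have "rapid (\<lambda>k. of_real (2 * pi * real CARD('n) * weight k) * a k)"
    by (rule rapid_mult[OF a, where D = "2 * pi * real CARD('n)" and m = 1])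
      (use weight_pos in \<open>auto simp: norm_mult abs_mult less_imp_le[OF weight_pos]\<close>)
  then have sc: "summable c" unfolding c_def by (rule rapid_summable_enum)
  have f'c: "cmod (f' j x h) \<le> c j * norm h" for j x h
  proof -
    have "\<bar>of_lattice (?e j) \<bullet> h\<bar> \<le> norm (of_lattice (?e j)) * norm h" by (rule Cauchy_Schwarz_ineq2)
    also have "\<dots> \<le> real CARD('n) * weight (?e j) * norm h"
      by (intro mult_right_mono norm_of_lattice_le_weight) auto
    finally have "2 * pi * cmod (a (?e j)) * \<bar>of_lattice (?e j) \<bullet> h\<bar> \<le>
        2 * pi * cmod (a (?e j)) * (real CARD('n) * weight (?e j) * norm h)"
      by (intro mult_left_mono) auto
    then show ?thesis
      using weight_pos[of "?e j"] by (simp add: f'_def c_def norm_mult abs_mult mult_ac)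
  qed
  have sf': "summable (\<lambda>j. cmod (f' j x h))" for x h
    by (rule summable_comparison_test'[OF summable_mult2[OF sc, of "norm h"]]) (use f'c in auto)
  have "\<exists>g. \<forall>x\<in>UNIV. (\<lambda>j. f j x) sums g x \<and> (g has_derivative F' x) (at x within UNIV)"
  proof (rule has_derivative_series)
    show "(f j has_derivative f' j x) (at x within UNIV)" for j x
      unfolding f_def f'_def by (rule has_derivative_mult_left[OF ch_has_derivative])
    show "(\<lambda>j. f j 0) sums fourier_series a 0" unfolding f_def by (rule fourier_series_sums[OF a])
    fix e :: real assume "e > 0"
    have "(\<lambda>n. \<Sum>j. c (j + n)) \<longlonglongrightarrow> 0" by (rule suminf_exist_split2[OF sc])
    then have "\<forall>\<^sub>F n in sequentially. (\<Sum>j. c (j + n)) < e"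
      using \<open>e > 0\<close> by (rule order_tendstoD)
    then show "\<forall>\<^sub>F n in sequentially. \<forall>x\<in>UNIV. \<forall>h. norm ((\<Sum>i<n. f' i x h) - F' x h) \<le> e * norm h"
    proof eventually_elim
      case (elim n)
      show ?case
      proof (intro ballI allI)
        fix x h
        have s1: "summable (\<lambda>j. cmod (f' (j + n) x h))" by (rule summable_ignore_initial_segment[OF sf'])
        have s2: "summable (\<lambda>j. c (j + n))" by (rule summable_ignore_initial_segment[OF sc])
        have "F' x h = (\<Sum>j. f' (j + n) x h) + (\<Sum>j<n. f' j x h)"
          unfolding F'_def by (rule suminf_split_initial_segment[OF summable_norm_cancel[OF sf']])
        then have "norm ((\<Sum>i<n. f' i x h) - F' x h) = norm (\<Sum>j. f' (j + n) x h)" by simp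
        also have "\<dots> \<le> (\<Sum>j. cmod (f' (j + n) x h))" by (rule summable_norm[OF s1])
        also have "\<dots> \<le> (\<Sum>j. c (j + n) * norm h)"
          by (intro suminf_le s1 summable_mult2 s2 f'c)
        also have "\<dots> = (\<Sum>j. c (j + n)) * norm h" by (rule suminf_mult2[OF s2, symmetric])
        also have "\<dots> \<le> e * norm h" using elim by (intro mult_right_mono) auto
        finally show "norm ((\<Sum>i<n. f' i x h) - F' x h) \<le> e * norm h" .
      qed
    qed
  qed auto
  then obtain g where g: "\<And>x. (\<lambda>j. f j x) sums g x" "\<And>x. (g has_derivative F' x) (at x)" by auto
  have "g = fourier_series a"
    using g(1) fourier_series_sums[OF a] unfolding f_def by (intro ext) (rule sums_unique2)
  show ?thesis
  proof (intro exI conjI allI)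
    show "(fourier_series a has_derivative F' x) (at x)" for x
      using g(2) by (simp add: \<open>g = fourier_series a\<close>)
    show "F' x (axis i 1) = fourier_series (\<lambda>k. 2 * of_real pi * \<i> * of_int (k $ i) * a k) x" for x i
    proof -
      have "f' j x (axis i 1) = ch (?e j) x * (2 * of_real pi * \<i> * of_int (?e j $ i) * a (?e j))" for j
        by (simp add: f'_def inner_axis mult_ac)
      then show ?thesis
        unfolding F'_def using sums_unique[OF fourier_series_sums[OF rapid_coord[OF a]]] by simp
    qed
  qed
qed

lemma C_k_fourier_series: "rapid a \<Longrightarrow> C_k r (fourier_series a)"
proof (induction r arbitrary: a)
  case 0
  obtain F' where "\<And>x. (fourier_series a has_derivative F' x) (at x)"
    "\<And>x i. F' x (axis i 1) = fourier_series (\<lambda>k. 2 * of_real pi * \<i> * of_int (k $ i) * a k) x"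
    using fourier_series_has_derivative[OF 0] by auto
  from this(1) have "isCont (fourier_series a) x" for x by (rule has_derivative_continuous)
  then show ?case by (simp add: continuous_at_imp_continuous_on)
next
  case (Suc r)
  obtain F' where F': "\<And>x. (fourier_series a has_derivative F' x) (at x)"
    "\<And>x i. F' x (axis i 1) = fourier_series (\<lambda>k. 2 * of_real pi * \<i> * of_int (k $ i) * a k) x"
    using fourier_series_has_derivative[OF Suc.prems] by auto
  have eq: "(\<lambda>x. frechet_derivative (fourier_series a) (at x) (axis i 1))
      = fourier_series (\<lambda>k. 2 * of_real pi * \<i> * of_int (k $ i) * a k)" for i
    unfolding frechet_derivative_at[OF F'(1), symmetric] by (rule ext) (rule F'(2))
  have "fourier_series a differentiable at x" for x
    unfolding differentiable_def by (intro exI[of _ "F' x"] F'(1))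
  then show ?case
    using Suc.IH[OF rapid_coord[OF Suc.prems]] unfolding C_k.simps eq by blast
qed

lemma periodic_fourier_series: "periodic (fourier_series a)"
  by (simp add: periodic_def fourier_series_def ch_shift)

lemma fourier_series_in_C_inf: "rapid a \<Longrightarrow> fourier_series a \<in> C_inf_torus"
  unfolding C_inf_torus_def using periodic_fourier_series C_k_fourier_series by blast

text \<open>Absolute convergence, uniform in \<open>x\<close>, permits termwise integration;
  orthonormality leaves one term.\<close>

lemma torus_FT_fourier_series:
  assumes a: "rapid (a :: int ^ 'n \<Rightarrow> complex)"
  shows "torus_FT (fourier_series a) = a"
proof
  fix m
  let ?e = "lattice_enum :: nat \<Rightarrow> int ^ 'n"
  define f where "f j x = ch (- m) x * (ch (?e j) x * a (?e j))" for j x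
  have norm_f: "cmod (f j x) = cmod (a (?e j))" for j x by (simp add: f_def norm_mult)
  have f_eq: "f j x = a (?e j) * (ch (?e j) x * cnj (ch m x))" for j x
    by (simp add: f_def ch_uminus mult_ac)
  have sn: "summable (\<lambda>j. cmod (a (?e j)))" by (rule rapid_summable_enum[OF a])
  have "(\<lambda>j. integral\<^sup>L torus (f j)) sums (LINT x|torus. (\<Sum>j. f j x))"
  proof (rule sums_integral)
    show "integrable torus (f j)" for j
      unfolding f_eq [abs_def] by (intro integrable_mult_right square_integrable_mult_cnj square_integrable_ch)
    show "AE x in torus. summable (\<lambda>j. norm (f j x))" by (simp add: norm_f sn)
    show "summable (\<lambda>j. LINT x|torus. norm (f j x))" by (simp add: norm_f sn summable_mult)
  qed
  also have "(\<lambda>x. \<Sum>j. f j x) = (\<lambda>x. ch (- m) x * fourier_series a x)"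
    unfolding f_def using sums_unique[OF sums_mult[OF fourier_series_sums[OF a]]] by simp
  also have "(LINT x|torus. ch (- m) x * fourier_series a x) = torus_FT (fourier_series a) m"
    by (simp add: torus_FT_def)
  also have "(\<lambda>j. integral\<^sup>L torus (f j)) = (\<lambda>j. if ?e j = m then a m else 0)"
    unfolding f_eq [abs_def] by (auto simp: integral_ch_mult_cnj)
  finally have 1: "(\<lambda>j. if ?e j = m then a m else 0) sums torus_FT (fourier_series a) m" .
  obtain j0 where j0: "?e j0 = m" using lattice_enum_surj by blast
  have "(\<lambda>j. if ?e j = m then a m else 0) sums a m"
    using sums_single[of j0 "\<lambda>_. a m"] by (simp flip: j0)
  with 1 show "torus_FT (fourier_series a) m = a m" by (rule sums_unique2)
qed

section \<open>Decay of the Fourier coefficients of smooth functions\<close>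

abbreviation partial_derivative :: "'n \<Rightarrow> (real ^ 'n \<Rightarrow> complex) \<Rightarrow> real ^ 'n \<Rightarrow> complex"
  where "partial_derivative i v \<equiv> (\<lambda>x. frechet_derivative v (at x) (axis i 1))"

lemma C_inf_has_derivative:
  assumes "v \<in> C_inf_torus"
  shows "(v has_derivative frechet_derivative v (at x)) (at x)"
proof -
  have "C_k (Suc 0) v" using assms by (simp only: C_inf_torus_def) simp
  then show ?thesis by (simp add: frechet_derivative_works[symmetric])
qed

lemma C_inf_continuous: "v \<in> C_inf_torus \<Longrightarrow> continuous_on S v"
  by (intro continuous_at_imp_continuous_on ballI has_derivative_continuous[OF C_inf_has_derivative])

lemma partial_derivative_C_inf:
  fixes v :: "real ^ 'n \<Rightarrow> complex"
  assumes v: "v \<in> C_inf_torus"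
  shows "partial_derivative i v \<in> C_inf_torus"
proof -
  have "C_k r (partial_derivative i v)" for r
  proof -
    have "C_k (Suc r) v" using v by (simp only: C_inf_torus_def) simp
    then show ?thesis by simp
  qed
  moreover have "periodic (partial_derivative i v)"
    unfolding periodic_def
  proof (intro allI)
    fix x :: "real ^ 'n" and m :: "int ^ 'n"
    have "((\<lambda>y. y + of_lattice m) has_derivative (\<lambda>h. h)) (at x)"
      by (auto intro!: derivative_eq_intros)
    from has_derivative_compose[OF this C_inf_has_derivative[OF v, where x = "x + of_lattice m"]]
    have "((\<lambda>y. v (y + of_lattice m)) has_derivative frechet_derivative v (at (x + of_lattice m))) (at x)"
      by simp
    moreover have "(\<lambda>y. v (y + of_lattice m)) = v"
      using v by (auto simp: C_inf_torus_def periodic_def)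
    ultimately have "(v has_derivative frechet_derivative v (at (x + of_lattice m))) (at x)" by simp
    then show "partial_derivative i v (x + of_lattice m) = partial_derivative i v x"
      using frechet_derivative_at by metis
  qed
  ultimately show ?thesis by (simp add: C_inf_torus_def)
qed

text \<open>Integration by parts without boundary terms: the product of \<open>ch (- k)\<close> and
  \<open>v\<close> is periodic, so its partial derivative has integral 0.\<close>

lemma torus_FT_partial_derivative:
  assumes v: "v \<in> C_inf_torus"
  shows "torus_FT (partial_derivative i v) k = 2 * of_real pi * \<i> * of_int (k $ i) * torus_FT v k"
proof -
  define w where "w x = ch (- k) x * v x" for x
  define w' where "w' x h = ch (- k) x * frechet_derivative v (at x) h +
    2 * of_real pi * \<i> * of_real (of_lattice (- k) \<bullet> h) * ch (- k) x * v x" for x h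
  have cd: "continuous_on S (partial_derivative i v)" for S
    by (rule C_inf_continuous[OF partial_derivative_C_inf[OF v]])
  have "(LINT x|torus. w' x (axis i 1)) = 0"
  proof (rule integral_partial_derivative_periodic)
    show "periodic w" unfolding w_def
      using v by (intro periodic_mult periodic_ch) (simp add: C_inf_torus_def)
    show "(w has_derivative w' x) (at x)" for x
      unfolding w_def w'_def by (intro has_derivative_mult ch_has_derivative C_inf_has_derivative v)
    show "continuous_on UNIV (\<lambda>x. w' x (axis i 1))"
      unfolding w'_def by (intro continuous_intros cd C_inf_continuous v)
  qed
  also have "(\<lambda>x. w' x (axis i 1)) = (\<lambda>x. ch (- k) x * partial_derivative i v x -
      2 * of_real pi * \<i> * of_int (k $ i) * (ch (- k) x * v x))"
    by (auto simp: w'_def inner_axis of_lattice_uminus mult_ac)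
  also have "(LINT x|torus. ch (- k) x * partial_derivative i v x -
      2 * of_real pi * \<i> * of_int (k $ i) * (ch (- k) x * v x)) =
      torus_FT (partial_derivative i v) k - 2 * of_real pi * \<i> * of_int (k $ i) * torus_FT v k"
  proof -
    have "integrable torus (\<lambda>x. ch (- k) x * partial_derivative i v x)"
      by (intro integrable_torus_continuous continuous_intros cd)
    moreover have "integrable torus (\<lambda>x. 2 * of_real pi * \<i> * of_int (k $ i) * (ch (- k) x * v x))"
      by (intro integrable_torus_continuous continuous_intros C_inf_continuous v)
    ultimately show ?thesis
      unfolding torus_FT_def by (subst Bochner_Integration.integral_diff) auto
  qed
  finally show ?thesis by simp
qed

lemma iterated_partial_derivative:
  assumes "v \<in> C_inf_torus"
  shows "(partial_derivative i ^^ m) v \<in> C_inf_torus \<and>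
    torus_FT ((partial_derivative i ^^ m) v) k = (2 * of_real pi * \<i> * of_int (k $ i)) ^ m * torus_FT v k"
proof (induction m)
  case (Suc m)
  then show ?case
    by (simp add: partial_derivative_C_inf torus_FT_partial_derivative)
qed (use assms in simp)

lemma torus_FT_bounded:
  assumes "continuous_on (cbox 0 1) v"
  shows "\<exists>C. \<forall>k. cmod (torus_FT v k) \<le> C"
proof (intro exI allI)
  fix k
  have "cmod (torus_FT v k) \<le> (LINT x|torus. cmod (ch (- k) x * v x))"
    unfolding torus_FT_def by (rule integral_norm_bound)
  then show "cmod (torus_FT v k) \<le> (LINT x|torus. cmod (v x))" by (simp add: norm_mult)
qed

text \<open>The \<open>m\<close>-th derivative in direction \<open>i\<close> is continuous, so its
  coefficients are bounded, and they are those of \<open>v\<close> times a factor of modulus at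
  least the \<open>m\<close>-th power of the coordinate.\<close>

lemma torus_FT_coord_bound:
  assumes v: "v \<in> C_inf_torus"
  shows "\<exists>C. \<forall>k. \<bar>real_of_int (k $ i)\<bar> ^ m * cmod (torus_FT v k) \<le> C"
proof -
  obtain C where C: "\<And>k. cmod (torus_FT ((partial_derivative i ^^ m) v) k) \<le> C"
    using torus_FT_bounded[OF C_inf_continuous] iterated_partial_derivative[OF v] by metis
  have "\<bar>real_of_int (k $ i)\<bar> ^ m * cmod (torus_FT v k) \<le> C" for k
  proof -
    have "1 * \<bar>real_of_int (k $ i)\<bar> \<le> (2 * pi) * \<bar>real_of_int (k $ i)\<bar>"
      using pi_gt3 by (intro mult_right_mono) auto
    then have "\<bar>real_of_int (k $ i)\<bar> ^ m * cmod (torus_FT v k)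
        \<le> ((2 * pi) * \<bar>real_of_int (k $ i)\<bar>) ^ m * cmod (torus_FT v k)"
      by (intro mult_right_mono power_mono) auto
    also have "\<dots> = cmod (torus_FT ((partial_derivative i ^^ m) v) k)"
      using iterated_partial_derivative[OF v, where i = i and m = m and k = k] by (simp add: norm_mult norm_power)
    finally show ?thesis using C[of k] by simp
  qed
  then show ?thesis by blast
qed

text \<open>Pure derivatives in one direction suffice: the weight is controlled by the largest
  coordinate of \<open>k\<close>, and the direction may depend on \<open>k\<close>.\<close>

lemma rapid_torus_FT:
  fixes v :: "real ^ 'n \<Rightarrow> complex"
  assumes v: "v \<in> C_inf_torus"
  shows "rapid (torus_FT v)"
  unfolding rapid_def
proof
  fix r
  \<comment> \<open>The weight is at most \<open>(1 + M^2) ^ CARD('n)\<close> for the largest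
    coordinate modulus \<open>M\<close>, so its \<open>r\<close>-th power is at most
    \<open>(1 + M^2) ^ p\<close>.\<close>
  define p where "p = CARD('n) * r"
  obtain C0 where C0: "\<And>k. cmod (torus_FT v k) \<le> C0"
    using torus_FT_bounded[OF C_inf_continuous[OF v]] by blast
  have "\<forall>i. \<exists>C. \<forall>k. \<bar>real_of_int (k $ i)\<bar> ^ (2 * p) * cmod (torus_FT v k) \<le> C"
    using torus_FT_coord_bound[OF v] by blast
  then obtain C where C: "\<And>i k. \<bar>real_of_int (k $ i)\<bar> ^ (2 * p) * cmod (torus_FT v k) \<le> C i"
    by metis
  have C_nn: "0 \<le> C i" for i by (rule order_trans[OF _ C[of 0 i]]) simp
  have "cmod (torus_FT v k) * weight k ^ r \<le> 2 ^ p * (C0 + (\<Sum>i\<in>UNIV. C i))" for k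
  proof -
    have "Max (range (\<lambda>i. \<bar>k $ i\<bar>)) \<in> range (\<lambda>i. \<bar>k $ i\<bar>)" by (intro Max_in) auto
    then obtain i where i: "\<bar>k $ i\<bar> = Max (range (\<lambda>i. \<bar>k $ i\<bar>))" by force
    have le: "\<bar>k $ j\<bar> \<le> \<bar>k $ i\<bar>" for j unfolding i by (intro Max_ge) auto
    define M where "M = \<bar>real_of_int (k $ i)\<bar>"
    have "weight k \<le> (\<Prod>j\<in>(UNIV :: 'n set). 1 + M\<^sup>2)"
      unfolding weight_def
    proof (intro prod_mono conjI add_left_mono)
      fix j :: 'n
      have "\<bar>real_of_int (k $ j)\<bar> \<le> M" using le[of j] by (simp add: M_def)
      then show "(real_of_int (k $ j))\<^sup>2 \<le> M\<^sup>2"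
        using power_mono[of "\<bar>real_of_int (k $ j)\<bar>" M 2] by simp
    qed auto
    then have "weight k \<le> (1 + M\<^sup>2) ^ CARD('n)" by simp
    then have "weight k ^ r \<le> ((1 + M\<^sup>2) ^ CARD('n)) ^ r"
      using weight_pos[of k] by (intro power_mono) auto
    also have "\<dots> = (1 + M\<^sup>2) ^ p" by (simp add: p_def power_mult)
    \<comment> \<open>Either summand of \<open>1 + M^2\<close> may dominate; each case costs a
      factor \<open>2 ^ p\<close>.\<close>
    also have "\<dots> \<le> 2 ^ p * (1 + M ^ (2 * p))"
    proof (cases "M\<^sup>2 \<le> 1")
      case True
      then have "(1 + M\<^sup>2) ^ p \<le> 2 ^ p" by (intro power_mono) auto
      also have "\<dots> \<le> 2 ^ p * (1 + M ^ (2 * p))" by (simp add: M_def)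
      finally show ?thesis .
    next
      case False
      then have "(1 + M\<^sup>2) ^ p \<le> (2 * M\<^sup>2) ^ p" by (intro power_mono) auto
      also have "\<dots> = 2 ^ p * M ^ (2 * p)" by (simp add: power_mult_distrib power_mult)
      finally show ?thesis by (simp add: distrib_left add_increasing)
    qed
    finally have "cmod (torus_FT v k) * weight k ^ r \<le> cmod (torus_FT v k) * (2 ^ p * (1 + M ^ (2 * p)))"
      by (intro mult_left_mono) auto
    also have "\<dots> = 2 ^ p * (cmod (torus_FT v k) + M ^ (2 * p) * cmod (torus_FT v k))"
      by (simp add: algebra_simps)
    also have "\<dots> \<le> 2 ^ p * (C0 + C i)"
      unfolding M_def by (intro mult_left_mono add_mono C0 C) auto
    \<comment> \<open>Summing over all directions makes the constant independent of
      \<open>i\<close>, hence of \<open>k\<close>.\<close>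
    also have "\<dots> \<le> 2 ^ p * (C0 + (\<Sum>i\<in>UNIV. C i))"
      using C_nn by (intro mult_left_mono add_left_mono member_le_sum) auto
    finally show ?thesis .
  qed
  then show "\<exists>C. \<forall>k. cmod (torus_FT v k) * weight k ^ r \<le> C" by blast
qed

subsection \<open>The two quantizations\<close>

lemma inner_torus_cnj: "cnj (inner_torus v w) = inner_torus w v"
  unfolding inner_torus_def by (simp flip: Bochner_Integration.integral_cnj add: mult.commute)

lemma square_integrable_C_inf: "v \<in> C_inf_torus \<Longrightarrow> square_integrable torus v"
  by (intro square_integrable_torus_continuous C_inf_continuous)

lemma torus_FT_eq_lattice_FT_inv: "torus_FT v k = lattice_FT_inv v (- k)"
  by (simp add: torus_FT_def lattice_FT_inv_def)

text \<open>The conjugate form of Parseval, reindexed by the reflection that relates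
  \<open>torus_FT\<close> to \<open>lattice_FT_inv\<close>.\<close>

lemma has_sum_inner_torus_lattice_FT:
  assumes "c \<in> l2_lattice" "square_integrable torus v"
  shows "((\<lambda>k. torus_FT v k * cnj (c (- k))) has_sum inner_torus v (lattice_FT c)) UNIV"
proof -
  have "((\<lambda>k. cnj (c k * cnj (lattice_FT_inv v k))) has_sum cnj (inner_torus (lattice_FT c) v)) UNIV"
    unfolding has_sum_cnj_iff by (rule has_sum_inner_lattice_FT[OF assms])
  then have "((\<lambda>k. lattice_FT_inv v k * cnj (c k)) has_sum inner_torus v (lattice_FT c)) UNIV"
    by (simp add: inner_torus_cnj mult.commute)
  then show ?thesis
    using has_sum_reindex_bij_betw[OF bij_uminus, of "\<lambda>k. lattice_FT_inv v k * cnj (c k)"]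
    by (simp add: torus_FT_eq_lattice_FT_inv)
qed

lemma infsum_delta:
  fixes f :: "'a \<Rightarrow> complex"
  shows "(\<Sum>\<^sub>\<infinity>k. if k = m then f k else 0) = f m"
proof (rule infsumI)
  have "((\<lambda>k. if k = m then f k else 0) has_sum (\<Sum>k\<in>{m}. f k)) UNIV"
    by (rule has_sum_finite_neutralI[where B = "{m}"]) auto
  then show "((\<lambda>k. if k = m then f k else 0) has_sum f m) UNIV" by simp
qed

lemma fourier_series_indicator: "fourier_series (\<lambda>k. if k = m then 1 else 0) = ch m"
proof
  fix x
  have "fourier_series (\<lambda>k. if k = m then 1 else 0) x = (\<Sum>\<^sub>\<infinity>k. if k = m then ch k x else 0)"
    unfolding fourier_series_def by (intro infsum_cong) auto
  then show "fourier_series (\<lambda>k. if k = m then 1 else 0) x = ch m x" by (simp only: infsum_delta)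
qed

lemma ch_in_C_inf: "ch m \<in> C_inf_torus"
  using fourier_series_in_C_inf[OF rapid_indicator[of m]] by (simp add: fourier_series_indicator)

lemma torus_FT_ch: "torus_FT (ch m) = (\<lambda>k. if k = m then 1 else 0)"
  using torus_FT_fourier_series[OF rapid_indicator[of m]] by (simp add: fourier_series_indicator)

lemma Op_torus_ch: "Op_torus \<tau> (ch m) x = ch m x * \<tau> x m"
proof -
  have "Op_torus \<tau> (ch m) x = (\<Sum>\<^sub>\<infinity>k. if k = m then ch k x * \<tau> x k else 0)"
    unfolding Op_torus_def torus_FT_ch by (intro infsum_cong) auto
  then show ?thesis by (simp only: infsum_delta)
qed

lemma square_integrable_Op_torus:
  "Op_torus_well_defined \<tau> \<Longrightarrow> v \<in> C_inf_torus \<Longrightarrow> square_integrable torus (Op_torus \<tau> v)"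
  by (auto simp: Op_torus_well_defined_def L2_torus_iff)

text \<open>Characters are smooth, and \<open>Op_torus \<tau>\<close> maps \<open>ch k\<close> to
  exactly this function, so the hypothesis applies to each term of the symbol separately.\<close>

lemma square_integrable_Op_torus_ch:
  assumes "Op_torus_well_defined \<tau>"
  shows "square_integrable torus (\<lambda>x. ch k x * \<tau> x k)"
  using square_integrable_Op_torus[OF assms ch_in_C_inf[of k]] by (simp add: Op_torus_ch [abs_def])

section \<open>Norm bounds for the symbol and the interchange of sum and integral\<close>

lemma AE_summable_symbol:
  assumes "Op_torus_well_defined \<tau>" "rapid a"
  shows "AE x in torus. (\<lambda>k. ch k x * \<tau> x k * a k) summable_on UNIV"
  using assms(1) fourier_series_in_C_inf[OF assms(2)]
  by (auto simp: Op_torus_well_defined_def torus_FT_fourier_series[OF assms(2)])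

lemma symbol_norms_bounded:
  fixes a :: "int ^ 'n \<Rightarrow> complex"
  assumes wd: "Op_torus_well_defined \<tau>" and a: "rapid a"
  shows "\<exists>C. \<forall>k. (cmod (a k))\<^sup>2 * (LINT x|torus. (cmod (ch k x * \<tau> x k))\<^sup>2) \<le> C"
proof -
  let ?e = "lattice_enum :: nat \<Rightarrow> int ^ 'n"
  define h where "h j x = ch (?e j) x * \<tau> x (?e j) * a (?e j)" for j x
  have sqh: "square_integrable torus (h j)" for j
    using square_integrable_cmult[OF square_integrable_Op_torus_ch[OF wd, of "?e j"], of "a (?e j)"]
    by (simp add: h_def [abs_def] mult_ac)
  have "\<exists>C. \<forall>j. (\<integral>\<^sup>+x. ennreal ((cmod (h j x))\<^sup>2) \<partial>torus) \<le> ennreal C"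
  proof (rule bounded_terms_of_square_integrable_subsums)
    show "h j \<in> borel_measurable torus" for j by (rule square_integrable_measurable[OF sqh])
    show "AE x in torus. summable (\<lambda>j. cmod (h j x))"
      using AE_summable_symbol[OF wd a] by (simp add: summable_on_lattice_iff h_def)
  next
    fix B :: "nat set"
    \<comment> \<open>Restriction to an arbitrary set of frequencies, written as a multiplier
      bounded by 1.\<close>
    define b where "b k = (if k \<in> ?e ` B then 1 else 0) * a k" for k
    have b: "rapid b"
      unfolding b_def by (rule rapid_mult[OF a, where D = 1 and m = 0]) simp
    have be: "b (?e j) = (if j \<in> B then a (?e j) else 0)" for j by (auto simp: b_def)
    have sq: "square_integrable torus (Op_torus \<tau> (fourier_series b))"
      by (intro square_integrable_Op_torus wd fourier_series_in_C_inf b)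
    have "AE x in torus. (\<Sum>j. if j \<in> B then h j x else 0) = Op_torus \<tau> (fourier_series b) x"
      using AE_summable_symbol[OF wd b]
    proof eventually_elim
      case (elim x)
      have "(\<lambda>j. if j \<in> B then h j x else 0) = (\<lambda>j. ch (?e j) x * \<tau> x (?e j) * b (?e j))"
        by (auto simp: be h_def)
      then show ?case
        using sums_unique[OF infsum_lattice_sums[OF elim]]
        by (simp add: Op_torus_def torus_FT_fourier_series[OF b])
    qed
    note ae = this
    have "(\<integral>\<^sup>+x. ennreal ((cmod (\<Sum>j. if j \<in> B then h j x else 0))\<^sup>2) \<partial>torus)
        = (\<integral>\<^sup>+x. ennreal ((cmod (Op_torus \<tau> (fourier_series b) x))\<^sup>2) \<partial>torus)"
      by (intro nn_integral_cong_AE, use ae in eventually_elim) simp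
    also have "\<dots> = ennreal (LINT x|torus. (cmod (Op_torus \<tau> (fourier_series b) x))\<^sup>2)"
      by (intro nn_integral_eq_integral square_integrable_integrable sq) auto
    finally show "(\<integral>\<^sup>+x. ennreal ((cmod (\<Sum>j. if j \<in> B then h j x else 0))\<^sup>2) \<partial>torus) < \<infinity>"
      by simp
  qed
  then obtain C where C: "\<And>j. (\<integral>\<^sup>+x. ennreal ((cmod (h j x))\<^sup>2) \<partial>torus) \<le> ennreal C" by blast
  \<comment> \<open>\<open>ennreal\<close> sends negative reals to 0, so the bound in the reals is
    \<open>max 0 C\<close>.\<close>
  have "(cmod (a k))\<^sup>2 * (LINT x|torus. (cmod (ch k x * \<tau> x k))\<^sup>2) \<le> max 0 C" for k
  proof -
    obtain j where j: "?e j = k" using lattice_enum_surj by blast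
    have "(cmod (a k))\<^sup>2 * (LINT x|torus. (cmod (ch k x * \<tau> x k))\<^sup>2) = (LINT x|torus. (cmod (h j x))\<^sup>2)"
      by (simp add: h_def j norm_mult power_mult_distrib mult.commute)
    moreover have "ennreal (LINT x|torus. (cmod (h j x))\<^sup>2) = (\<integral>\<^sup>+x. ennreal ((cmod (h j x))\<^sup>2) \<partial>torus)"
      by (intro nn_integral_eq_integral[symmetric] square_integrable_integrable sqh) auto
    moreover have "ennreal C \<le> ennreal (max 0 C)" by (intro ennreal_leI) simp
    ultimately have "ennreal ((cmod (a k))\<^sup>2 * (LINT x|torus. (cmod (ch k x * \<tau> x k))\<^sup>2)) \<le> ennreal (max 0 C)"
      using C[of j] by (metis order_trans)
    then show ?thesis by (subst (asm) ennreal_le_iff) auto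
  qed
  then show ?thesis by blast
qed

text \<open>One extra factor \<open>weight\<close> on the coefficients is enough: after square roots
  the terms are at most a constant over the weight, which is summable.\<close>

lemma symbol_norms_summable:
  fixes a :: "int ^ 'n \<Rightarrow> complex"
  assumes wd: "Op_torus_well_defined \<tau>" and a: "rapid a"
  shows "(\<lambda>k. cmod (a k) * sqrt (LINT x|torus. (cmod (ch k x * \<tau> x k))\<^sup>2)) summable_on UNIV"
proof -
  define n where "n k = (LINT x|torus. (cmod (ch k x * \<tau> x k))\<^sup>2)" for k
  have n0: "n k \<ge> 0" for k by (simp add: n_def)
  have "rapid (\<lambda>k. of_real (weight k) * a k)"
    by (rule rapid_mult[OF a, where D = 1 and m = 1]) (simp add: less_imp_le[OF weight_pos])
  from symbol_norms_bounded[OF wd this] obtain C where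
    C: "\<And>k. (cmod (of_real (weight k) * a k))\<^sup>2 * n k \<le> C" unfolding n_def by blast
  have "(\<lambda>k :: int ^ 'n. sqrt C * (1 / weight k)) summable_on UNIV"
    by (intro summable_on_cmult_right summable_inverse_weight)
  then show ?thesis
  proof (rule summable_on_comparison_test)
    fix k :: "int ^ 'n"
    have "sqrt ((cmod (of_real (weight k) * a k))\<^sup>2 * n k) \<le> sqrt C"
      using C by (rule real_sqrt_le_mono)
    then have "weight k * (cmod (a k) * sqrt (n k)) \<le> sqrt C"
      by (simp add: real_sqrt_mult norm_mult less_imp_le[OF weight_pos])
    then show "cmod (a k) * sqrt (LINT x|torus. (cmod (ch k x * \<tau> x k))\<^sup>2) \<le> sqrt C * (1 / weight k)"
      using weight_pos[of k] by (simp add: n_def field_simps)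
  qed (simp add: n_def)
qed

text \<open>By Cauchy-Schwarz the \<open>L^1\<close> norms of the terms are at most the summable
  quantities of \<open>symbol_norms_summable\<close> times the norm of \<open>\<phi>\<close>, so sum
  and integral commute.\<close>

lemma has_sum_inner_Op_torus:
  fixes v :: "real ^ 'n \<Rightarrow> complex"
  assumes wd: "Op_torus_well_defined \<tau>" and v: "v \<in> C_inf_torus" and \<phi>: "square_integrable torus \<phi>"
  shows "((\<lambda>k. torus_FT v k * inner_torus (\<lambda>x. ch k x * \<tau> x k) \<phi>) has_sum
    inner_torus (Op_torus \<tau> v) \<phi>) UNIV"
proof -
  let ?e = "lattice_enum :: nat \<Rightarrow> int ^ 'n"
  define g where "g k x = ch k x * \<tau> x k" for k x
  define a where "a = torus_FT v"
  have a: "rapid a" unfolding a_def by (rule rapid_torus_FT[OF v])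
  have sqg: "square_integrable torus (g k)" for k
    unfolding g_def [abs_def] by (rule square_integrable_Op_torus_ch[OF wd])
  define f where "f j x = a (?e j) * (g (?e j) x * cnj (\<phi> x))" for j x
  define n where "n k = cmod (a k) * sqrt (LINT x|torus. (cmod (g k x))\<^sup>2)" for k
  define N where "N = sqrt (LINT x|torus. (cmod (\<phi> x))\<^sup>2)"
  have "(\<lambda>k. complex_of_real (n k)) summable_on UNIV"
    using symbol_norms_summable[OF wd a] by (intro summable_on_of_real) (simp add: n_def g_def)
  then have "summable (\<lambda>j. n (?e j))"
    by (simp add: summable_on_lattice_iff n_def norm_mult)
  then have sn: "summable (\<lambda>j. n (?e j) * N)" by (rule summable_mult2)
  have intf: "integrable torus (f j)" for j
    unfolding f_def [abs_def] by (intro integrable_mult_right square_integrable_mult_cnj sqg \<phi>)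
  have le: "(LINT x|torus. cmod (f j x)) \<le> n (?e j) * N" for j
  proof -
    have "(LINT x|torus. cmod (f j x)) = cmod (a (?e j)) * (LINT x|torus. cmod (g (?e j) x) * cmod (\<phi> x))"
      by (simp add: f_def norm_mult)
    also have "\<dots> \<le> cmod (a (?e j)) * (sqrt (LINT x|torus. (cmod (g (?e j) x))\<^sup>2) * N)"
      unfolding N_def by (intro mult_left_mono integral_norm_mult_le sqg \<phi>) auto
    finally show ?thesis by (simp add: n_def mult_ac)
  qed
  have sI: "summable (\<lambda>j. LINT x|torus. cmod (f j x))"
    by (rule summable_comparison_test'[OF sn]) (use le in auto)
  have ae: "AE x in torus. summable (\<lambda>j. norm (f j x)) \<and> (\<Sum>j. f j x) = Op_torus \<tau> v x * cnj (\<phi> x)"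
    using AE_summable_symbol[OF wd a]
  proof eventually_elim
    case (elim x)
    have "summable (\<lambda>j. cmod (ch (?e j) x * \<tau> x (?e j) * a (?e j)) * cmod (\<phi> x))"
      using elim by (intro summable_mult2) (simp add: summable_on_lattice_iff)
    then have "summable (\<lambda>j. norm (f j x))" by (simp add: f_def g_def norm_mult mult_ac)
    moreover have "(\<lambda>j. ch (?e j) x * \<tau> x (?e j) * a (?e j) * cnj (\<phi> x)) sums (Op_torus \<tau> v x * cnj (\<phi> x))"
      using sums_mult2[OF infsum_lattice_sums[OF elim], of "cnj (\<phi> x)"] by (simp add: Op_torus_def a_def)
    then have "(\<lambda>j. f j x) sums (Op_torus \<tau> v x * cnj (\<phi> x))" by (simp add: f_def g_def mult_ac)
    ultimately show ?case by (simp add: sums_iff)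
  qed
  have "(\<lambda>j. integral\<^sup>L torus (f j)) sums (LINT x|torus. (\<Sum>j. f j x))"
    by (rule sums_integral) (use intf ae sI in auto)
  also have "(LINT x|torus. (\<Sum>j. f j x)) = inner_torus (Op_torus \<tau> v) \<phi>"
    unfolding inner_torus_def
  proof (rule integral_cong_AE)
    show "(\<lambda>x. \<Sum>j. f j x) \<in> borel_measurable torus"
      using intf[THEN borel_measurable_integrable] by measurable
    show "(\<lambda>x. Op_torus \<tau> v x * cnj (\<phi> x)) \<in> borel_measurable torus"
      by (intro borel_measurable_integrable square_integrable_mult_cnj square_integrable_Op_torus wd v \<phi>)
  qed (use ae in auto)
  finally have S: "(\<lambda>j. integral\<^sup>L torus (f j)) sums inner_torus (Op_torus \<tau> v) \<phi>" .
  \<comment> \<open>Absolute convergence upgrades the series along the enumeration to an unordered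
    sum.\<close>
  have "summable (\<lambda>j. norm (integral\<^sup>L torus (f j)))"
    by (rule summable_comparison_test'[OF sI]) (use integral_norm_bound in auto)
  from norm_summable_imp_has_sum[OF this S]
  have "((\<lambda>j. integral\<^sup>L torus (f j)) has_sum inner_torus (Op_torus \<tau> v) \<phi>) UNIV" .
  moreover have "integral\<^sup>L torus (f j) = (\<lambda>k. a k * inner_torus (g k) \<phi>) (?e j)" for j
    by (simp add: f_def [abs_def] inner_torus_def)
  ultimately have "((\<lambda>k. a k * inner_torus (g k) \<phi>) has_sum inner_torus (Op_torus \<tau> v) \<phi>) UNIV"
    using has_sum_reindex_bij_betw[OF bij_lattice_enum, of "\<lambda>k. a k * inner_torus (g k) \<phi>"] by simp
  then show ?thesis by (simp add: a_def g_def [abs_def])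
qed

section \<open>Uniqueness of adjoint values on the lattice\<close>

lemma l2_lattice_diff:
  assumes "f \<in> l2_lattice" "g \<in> l2_lattice"
  shows "(\<lambda>k. f k - g k) \<in> l2_lattice"
proof -
  have "(\<lambda>k. 2 * (cmod (f k))\<^sup>2 + 2 * (cmod (g k))\<^sup>2) summable_on UNIV"
    using assms by (intro summable_on_add summable_on_cmult_right) (auto simp: l2_lattice_def)
  then have "(\<lambda>k. (cmod (f k - g k))\<^sup>2) summable_on UNIV"
  proof (rule summable_on_comparison_test)
    fix k
    have "(cmod (f k - g k))\<^sup>2 \<le> (cmod (f k) + cmod (g k))\<^sup>2"
      by (intro power_mono norm_triangle_ineq4) auto
    moreover have "0 \<le> (cmod (f k) - cmod (g k))\<^sup>2" by simp
    ultimately show "(cmod (f k - g k))\<^sup>2 \<le> 2 * (cmod (f k))\<^sup>2 + 2 * (cmod (g k))\<^sup>2"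
      unfolding power2_diff power2_sum by linarith
  qed auto
  then show ?thesis by (simp add: l2_lattice_def)
qed

lemma l2_lattice_mult_cnj_summable:
  assumes "f \<in> l2_lattice" "g \<in> l2_lattice"
  shows "(\<lambda>k. f k * cnj (g k)) summable_on UNIV"
proof -
  have "(\<lambda>k. (cmod (f k))\<^sup>2 + (cmod (g k))\<^sup>2) summable_on UNIV"
    using assms by (intro summable_on_add) (auto simp: l2_lattice_def)
  then have "(\<lambda>k. cmod (f k * cnj (g k))) summable_on UNIV"
  proof (rule summable_on_comparison_test)
    fix k
    have "0 \<le> (cmod (f k) - cmod (g k))\<^sup>2" "0 \<le> cmod (f k) * cmod (g k)" by auto
    then show "cmod (f k * cnj (g k)) \<le> (cmod (f k))\<^sup>2 + (cmod (g k))\<^sup>2"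
      unfolding power2_diff norm_mult complex_mod_cnj by linarith
  qed auto
  then show ?thesis by (simp add: summable_on_iff_abs_summable_on_complex)
qed

lemma has_sum_diff:
  fixes f g :: "'a \<Rightarrow> 'b :: real_normed_vector"
  assumes "(f has_sum a) A" "(g has_sum b) A"
  shows "((\<lambda>x. f x - g x) has_sum (a - b)) A"
proof -
  have "((\<lambda>x. - g x) has_sum (- b)) A" using assms(2) by (simp add: has_sum_uminus)
  from has_sum_add[OF assms(1) this] show ?thesis by simp
qed

text \<open>By Pythagoras the squared distance from \<open>d\<close> to an orthogonal
  \<open>f\<close> is at least the squared norm of \<open>d\<close>, while density makes it
  arbitrarily small.\<close>

lemma dense_orthogonal_eq_0:
  assumes dense: "dense_l2_lattice D" and D: "D \<subseteq> l2_lattice" and d: "d \<in> l2_lattice"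
    and orth: "\<And>f. f \<in> D \<Longrightarrow> inner_lattice f d = 0"
  shows "d = (\<lambda>k. 0)"
proof
  fix m
  have "(cmod (d m))\<^sup>2 \<le> 0"
  proof (rule field_le_epsilon)
    fix e :: real assume "e > 0"
    then obtain f where f: "f \<in> D" "(\<Sum>\<^sub>\<infinity>k. (cmod (d k - f k))\<^sup>2) < e"
      using dense d unfolding dense_l2_lattice_def by blast
    have fl: "f \<in> l2_lattice" using f(1) D by blast
    have sd: "(\<lambda>k. (cmod (d k))\<^sup>2) summable_on UNIV" and sf: "(\<lambda>k. (cmod (f k))\<^sup>2) summable_on UNIV"
      using d fl by (auto simp: l2_lattice_def)
    have sfd: "(\<lambda>k. f k * cnj (d k)) summable_on UNIV" by (rule l2_lattice_mult_cnj_summable[OF fl d])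
    have "((\<lambda>k. f k * cnj (d k)) has_sum 0) UNIV"
      using has_sum_infsum[OF sfd] orth[OF f(1)] by (simp add: inner_lattice_def)
    then have "((\<lambda>k. Re (f k * cnj (d k))) has_sum 0) UNIV"
      using has_sum_Re by fastforce
    then have "((\<lambda>k. 2 * Re (f k * cnj (d k))) has_sum 2 * 0) UNIV" by (rule has_sum_cmult_right)
    then have "((\<lambda>k. ((cmod (d k))\<^sup>2 + (cmod (f k))\<^sup>2) - 2 * Re (f k * cnj (d k))) has_sum
        ((\<Sum>\<^sub>\<infinity>k. (cmod (d k))\<^sup>2) + (\<Sum>\<^sub>\<infinity>k. (cmod (f k))\<^sup>2)) - 2 * 0) UNIV"
      by (intro has_sum_diff has_sum_add has_sum_infsum sd sf)
    moreover have "(cmod (d k))\<^sup>2 + (cmod (f k))\<^sup>2 - 2 * Re (f k * cnj (d k)) = (cmod (d k - f k))\<^sup>2" for k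
      by (simp add: cmod_power2 power2_diff algebra_simps) 
    ultimately have "((\<lambda>k. (cmod (d k - f k))\<^sup>2) has_sum
        ((\<Sum>\<^sub>\<infinity>k. (cmod (d k))\<^sup>2) + (\<Sum>\<^sub>\<infinity>k. (cmod (f k))\<^sup>2))) UNIV" by simp
    then have "(\<Sum>\<^sub>\<infinity>k. (cmod (d k - f k))\<^sup>2) = (\<Sum>\<^sub>\<infinity>k. (cmod (d k))\<^sup>2) + (\<Sum>\<^sub>\<infinity>k. (cmod (f k))\<^sup>2)"
      by (rule infsumI)
    moreover have "0 \<le> (\<Sum>\<^sub>\<infinity>k. (cmod (f k))\<^sup>2)" by (rule infsum_nonneg) simp
    moreover have "(\<Sum>k\<in>{m}. (cmod (d k))\<^sup>2) \<le> (\<Sum>\<^sub>\<infinity>k. (cmod (d k))\<^sup>2)"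
      by (intro finite_sum_le_infsum sd) auto
    ultimately show "(cmod (d m))\<^sup>2 \<le> 0 + e" using f(2) by simp
  qed
  then show "d m = 0" by simp
qed

lemma is_adjoint_value_unique_lattice:
  assumes dense: "dense_l2_lattice D" and D: "D \<subseteq> l2_lattice"
    and "is_adjoint_value l2_lattice inner_lattice D A g h"
    and "is_adjoint_value l2_lattice inner_lattice D A g h'"
  shows "h = h'"
proof -
  have h: "h \<in> l2_lattice" "h' \<in> l2_lattice"
    and eq: "\<And>f. f \<in> D \<Longrightarrow> inner_lattice f h = inner_lattice f h'"
    using assms(3,4) by (auto simp: is_adjoint_value_def)
  have "(\<lambda>k. h k - h' k) = (\<lambda>k. 0)"
  proof (rule dense_orthogonal_eq_0[OF dense D l2_lattice_diff[OF h]])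
    fix f assume f: "f \<in> D"
    then have fl: "f \<in> l2_lattice" using D by blast
    have "inner_lattice f (\<lambda>k. h k - h' k) = (\<Sum>\<^sub>\<infinity>k. f k * cnj (h k) - f k * cnj (h' k))"
      by (simp add: inner_lattice_def right_diff_distrib)
    also have "\<dots> = inner_lattice f h - inner_lattice f h'"
      unfolding inner_lattice_def by (intro infsumI has_sum_diff has_sum_infsum l2_lattice_mult_cnj_summable fl h)
    also have "\<dots> = 0" using eq[OF f] by simp
    finally show "inner_lattice f (\<lambda>k. h k - h' k) = 0" .
  qed
  then show ?thesis by (auto simp: fun_eq_iff)
qed

lemma Op_lattice_eq_inner:
  assumes "\<And>x k. \<tau> x k = cnj (\<sigma> (- k) x)"
  shows "Op_lattice \<sigma> f k = cnj (inner_torus (\<lambda>x. ch (- k) x * \<tau> x (- k)) (lattice_FT f))"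
  unfolding inner_torus_cnj
  by (simp add: Op_lattice_def inner_torus_def assms ch_uminus mult_ac)

text \<open>The operators may be unbounded, so the first identity includes equality of domains. The
  toroidal operator starts from \<open>C_inf_torus\<close>, so the second is asserted on smooth
  functions, and as an identity in \<open>L^2\<close> it holds almost everywhere.\<close>

theorem theorem4p1:
  fixes \<sigma> :: "int ^ 'n \<Rightarrow> real ^ 'n \<Rightarrow> complex"
    and \<tau> :: "real ^ 'n \<Rightarrow> int ^ 'n \<Rightarrow> complex"
  assumes \<sigma>_torus: "\<And>k. periodic (\<sigma> k)"
    and \<tau>_eq: "\<And>x k. \<tau> x k = cnj (\<sigma> (- k) x)"
    and well_defined: "Op_torus_well_defined \<tau>"
  shows "dom_lattice \<sigma> = {f \<in> l2_lattice. lattice_FT f \<in> dom_Op_torus_adj \<tau>} \<and>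
     (\<forall>f\<in>dom_lattice \<sigma>.
        Op_lattice \<sigma> f = (lattice_FT_inv \<circ> Op_torus_adj \<tau> \<circ> lattice_FT) f) \<and>
     (dense_l2_lattice (dom_lattice \<sigma>) \<longrightarrow>
       (\<forall>v\<in>C_inf_torus. lattice_FT_inv v \<in> dom_Op_lattice_adj \<sigma> \<and>
          (AE x in torus.
             Op_torus \<tau> v x = (lattice_FT \<circ> Op_lattice_adj \<sigma> \<circ> lattice_FT_inv) v x)))"
proof -
  let ?adj = "is_adjoint_value L2_torus inner_torus C_inf_torus (Op_torus \<tau>)"
  let ?adj' = "is_adjoint_value l2_lattice inner_lattice (dom_lattice \<sigma>) (Op_lattice \<sigma>)"
  note Op_eq = Op_lattice_eq_inner[of \<tau> \<sigma>, OF \<tau>_eq]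
  have dom_l2: "f \<in> l2_lattice" "Op_lattice \<sigma> f \<in> l2_lattice" if "f \<in> dom_lattice \<sigma>" for f
    using that by (auto simp: dom_lattice_def)
  \<comment> \<open>Testing an adjoint value against characters fixes its Fourier coefficients,
    whichever representative it is.\<close>
  have Op_lattice_eq: "Op_lattice \<sigma> f = lattice_FT_inv h" if h: "?adj (lattice_FT f) h" for f h
  proof
    fix k
    have "inner_torus (Op_torus \<tau> (ch (- k))) (lattice_FT f) = inner_torus (ch (- k)) h"
      using h ch_in_C_inf unfolding is_adjoint_value_def by blast
    then have "Op_lattice \<sigma> f k = cnj (inner_torus (ch (- k)) h)"
      by (simp add: Op_eq Op_torus_ch [abs_def])
    then show "Op_lattice \<sigma> f k = lattice_FT_inv h k"
      by (simp add: inner_torus_cnj lattice_FT_inv_eq_inner)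
  qed
  \<comment> \<open>Both sides are the sum of the same unordered series, by the interchange on the
    left and Parseval on the right.\<close>
  have inner_eq: "inner_torus (Op_torus \<tau> v) (lattice_FT f) = inner_torus v (lattice_FT (Op_lattice \<sigma> f))"
    if f: "f \<in> dom_lattice \<sigma>" and v: "v \<in> C_inf_torus" for f v
  proof -
    have "((\<lambda>k. torus_FT v k * cnj (Op_lattice \<sigma> f (- k))) has_sum
        inner_torus (Op_torus \<tau> v) (lattice_FT f)) UNIV"
      using has_sum_inner_Op_torus[OF well_defined v square_integrable_lattice_FT[OF dom_l2(1)[OF f]]]
      by (simp add: Op_eq)
    then show ?thesis
      by (rule has_sum_unique)
        (rule has_sum_inner_torus_lattice_FT[OF dom_l2(2)[OF f] square_integrable_C_inf[OF v]])
  qed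
  have adj: "?adj (lattice_FT f) (lattice_FT (Op_lattice \<sigma> f))" if "f \<in> dom_lattice \<sigma>" for f
    using that inner_eq dom_l2 by (simp add: is_adjoint_value_def lattice_FT_in_L2)
  have dom: "dom_lattice \<sigma> = {f \<in> l2_lattice. lattice_FT f \<in> dom_Op_torus_adj \<tau>}"
  proof (intro set_eqI iffI)
    fix f assume f: "f \<in> dom_lattice \<sigma>"
    show "f \<in> {f \<in> l2_lattice. lattice_FT f \<in> dom_Op_torus_adj \<tau>}"
      using adj[OF f] dom_l2[OF f] by (auto simp: adjoint_dom_def lattice_FT_in_L2)
  next
    fix f assume "f \<in> {f \<in> l2_lattice. lattice_FT f \<in> dom_Op_torus_adj \<tau>}"
    then obtain h where f: "f \<in> l2_lattice" and h: "?adj (lattice_FT f) h"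
      by (auto simp: adjoint_dom_def)
    \<comment> \<open>Square integrability of each symbol term gives existence of the integrals;
      Bessel's inequality for \<open>h\<close> then gives membership in
      \<open>l2_lattice\<close>.\<close>
    have "integrable torus (\<lambda>x. ch k x * \<sigma> k x * lattice_FT f x)" for k
    proof -
      have "integrable torus (\<lambda>x. lattice_FT f x * cnj (ch (- k) x * \<tau> x (- k)))"
        by (intro square_integrable_mult_cnj square_integrable_lattice_FT f
            square_integrable_Op_torus_ch well_defined)
      then show ?thesis by (simp add: \<tau>_eq ch_uminus mult_ac)
    qed
    moreover have "Op_lattice \<sigma> f \<in> l2_lattice"
      unfolding Op_lattice_eq[OF h] using h
      by (intro lattice_FT_inv_in_l2) (simp add: is_adjoint_value_def L2_torus_iff)
    ultimately show "f \<in> dom_lattice \<sigma>" using f by (simp add: dom_lattice_def)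
  qed
  have first: "Op_lattice \<sigma> f = (lattice_FT_inv \<circ> Op_torus_adj \<tau> \<circ> lattice_FT) f"
    if f: "f \<in> dom_lattice \<sigma>" for f
  proof -
    \<comment> \<open>Some adjoint value exists, so the chosen one is an adjoint value too, and the
      coefficient computation holds for any of them.\<close>
    have "?adj (lattice_FT f) (Op_torus_adj \<tau> (lattice_FT f))"
      unfolding adjoint_op_def using adj[OF f] by (rule someI[of "?adj (lattice_FT f)"])
    then show ?thesis by (simp add: Op_lattice_eq)
  qed
  have second: "lattice_FT_inv v \<in> dom_Op_lattice_adj \<sigma> \<and>
      (AE x in torus. Op_torus \<tau> v x = (lattice_FT \<circ> Op_lattice_adj \<sigma> \<circ> lattice_FT_inv) v x)"
    if dense: "dense_l2_lattice (dom_lattice \<sigma>)" and v: "v \<in> C_inf_torus" for v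
  proof -
    define u where "u = Op_torus \<tau> v"
    have u: "square_integrable torus u"
      unfolding u_def by (rule square_integrable_Op_torus[OF well_defined v])
    \<comment> \<open>The conjugate of \<open>inner_eq\<close>, carried to the lattice by Parseval
      on both sides.\<close>
    have adj': "?adj' (lattice_FT_inv v) (lattice_FT_inv u)"
      unfolding is_adjoint_value_def
    proof (intro conjI ballI lattice_FT_inv_in_l2 u)
      fix f assume f: "f \<in> dom_lattice \<sigma>"
      have "inner_lattice (Op_lattice \<sigma> f) (lattice_FT_inv v) = inner_torus (lattice_FT (Op_lattice \<sigma> f)) v"
        unfolding inner_lattice_def
        by (rule infsumI[OF has_sum_inner_lattice_FT[OF dom_l2(2)[OF f] square_integrable_C_inf[OF v]]])
      also have "\<dots> = inner_torus (lattice_FT f) u"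
        using inner_eq[OF f v] unfolding u_def by (metis inner_torus_cnj)
      also have "\<dots> = inner_lattice f (lattice_FT_inv u)"
        unfolding inner_lattice_def
        by (rule infsumI[OF has_sum_inner_lattice_FT[OF dom_l2(1)[OF f] u], symmetric])
      finally show "inner_lattice (Op_lattice \<sigma> f) (lattice_FT_inv v) = inner_lattice f (lattice_FT_inv u)" .
    qed
    have "?adj' (lattice_FT_inv v) (Op_lattice_adj \<sigma> (lattice_FT_inv v))"
      unfolding adjoint_op_def using adj' by (rule someI[of "?adj' (lattice_FT_inv v)"])
    \<comment> \<open>Density turns the choice in \<open>adjoint_op\<close> into an equality of
      sequences; Fourier inversion then recovers \<open>u\<close>.\<close>
    then have "Op_lattice_adj \<sigma> (lattice_FT_inv v) = lattice_FT_inv u"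
      using is_adjoint_value_unique_lattice[OF dense subsetI[OF dom_l2(1)] _ adj'] by simp
    moreover have "lattice_FT_inv v \<in> dom_Op_lattice_adj \<sigma>"
      unfolding adjoint_dom_def
      using adj' lattice_FT_inv_in_l2[OF square_integrable_C_inf[OF v]] by blast
    ultimately show ?thesis
      using lattice_FT_lattice_FT_inv[OF u] by (simp add: u_def eq_commute)
  qed
  show ?thesis using dom first second by blast
qed

end
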